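(* Let $q\in\mathbb{C}$ be nonzero with $q^2\neq 1$, let $d\ge 0$ be an integer, let $V$ be a vector space over $\mathbb{C}$ of dimension $d+1$, and let $\Phi=(A;\{E_i\}_{i=0}^d;A^*;\{E^*_i\}_{i=0}^d)$ be a Leonard system on $V$ of dual $q$-Krawtchouk type, with parameters $h,h^*,\kappa,\kappa^*,\upsilon$. Fix $\epsilon\in\{1,-1\}$. Then there exists a unique $U_q(\mathfrak{sl}_2)$-module structure on $V$ such that on $V$ $$A=h1+\epsilon\kappa y+\epsilon\upsilon x,\qquad A^*=h^*1+\epsilon\kappa^* z .$$
   Context: A Leonard system on $V$ is a sequence $\Phi=(A;\{E_i\}_{i=0}^d;A^*;\{E^*_i\}_{i=0}^d)$ with: $A,A^*\in\mathrm{End}(V)$ each having $d+1$ distinct eigenvalues; $\{E_i\}$ an ordering of the primitive idempotents of $A$ (the projections onto the eigenspaces along the other eigenspaces) and $\{E^*_i\}$ an ordering of those of $A^*$; $E_iA^*E_j=0$ if $|i-j|>1$ and $\neq0$ if $|i-j|=1$; and $E^*_iAE^*_j=0$ if $|i-j|>1$ and $\neq 0$ if $|i-j|=1$ ($0\le i,j\le d$). Let $\theta_i$ (resp. $\theta^*_i$) be the eigenvalue of $A$ (resp. $A^*$) for $E_i$ (resp. $E^*_i$). For $0\le i\le d$ put $U_i=(E^*_0V+\dots+E^*_iV)\cap(E_iV+\dots+E_dV)$; each $U_i$ is one-dimensional and for $1\le i\le d$ the map $(A-\theta_{i-1}I)(A^*-\theta^*_iI)$ acts on $U_i$ as a nonzero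 scalar $\varphi_i$ (the first split sequence). The second split sequence $\{\phi_i\}_{i=1}^d$ is the first split sequence of the Leonard system $(A;\{E_{d-i}\}_{i=0}^d;A^*;\{E^*_i\}_{i=0}^d)$. $\Phi$ has dual $q$-Krawtchouk type if there are $h,h^*,\kappa,\kappa^*,\upsilon\in\mathbb{C}$ with $\kappa,\kappa^*,\upsilon\neq0$ such that $\theta_i=h+\kappa q^{d-2i}+\upsilon q^{2i-d}$, $\theta^*_i=h^*+\kappa^*q^{d-2i}$ ($0\le i\le d$), and $\varphi_i=\kappa\kappa^*q^{d+1-2i}(q^i-q^{-i})(q^{i-d-1}-q^{d+1-i})$, $\phi_i=\kappa^*\upsilon q^{d+1-2i}(q^i-q^{-i})(q^{i-d-1}-q^{d+1-i})$ ($1\le i\le d$). $U_q(\mathfrak{sl}_2)$ is the $\mathbb{C}$-algebra with generators $x,y,z^{\pm1}$ and relations $zz^{-1}=z^{-1}z=1$, $\frac{qxy-q^{-1}yx}{q-q^{-1}}=1$, $\frac{qyz-q^{-1}zy}{q-q^{-1}}=1$, $\frac{qzx-q^{-1}xz}{q-q^{-1}}=1$.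
   Formalization: The case d = 1 with q² = -1 is excluded: there the relations leave the off-diagonal entries of x and y underdetermined, so uniqueness of the module structure always fails (e.g. q = i, h = h* = 0, κ = 2, υ = 5, κ* = 3). *)

theory Defs
  imports Complex_Main "HOL-Library.FuncSet" "HOL-Algebra.QuotRing"
begin

section \<open>Leonard systems\<close>

text \<open>
  \<open>V\<close> is the whole of a type \<open>'v\<close>, made into a complex vector space by \<open>scale\<close>. A sequence indexed
  by \<open>0,\<dots>,d\<close> (or \<open>1,\<dots>,d\<close>) is a function on \<open>nat\<close>; its other values are irrelevant.
\<close>

definition eigenspace :: "(complex \<Rightarrow> 'v::ab_group_add \<Rightarrow> 'v) \<Rightarrow> ('v \<Rightarrow> 'v) \<Rightarrow> complex \<Rightarrow> 'v set" where
  "eigenspace scale T t = {v. T v = scale t v}"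

definition eigenvalues :: "(complex \<Rightarrow> 'v::ab_group_add \<Rightarrow> 'v) \<Rightarrow> ('v \<Rightarrow> 'v) \<Rightarrow> complex set" where
  "eigenvalues scale T = {t. \<exists>v. v \<noteq> 0 \<and> v \<in> eigenspace scale T t}"

text \<open>
  \<open>P\<close> is the projection onto the eigenspace of \<open>t\<close> along the other eigenspaces. This determines
  \<open>P\<close> when \<open>V\<close> is the sum of the eigenspaces of \<open>T\<close>.
\<close>

definition eigenprojection ::
    "(complex \<Rightarrow> 'v::ab_group_add \<Rightarrow> 'v) \<Rightarrow> ('v \<Rightarrow> 'v) \<Rightarrow> complex \<Rightarrow> ('v \<Rightarrow> 'v) \<Rightarrow> bool" where
  "eigenprojection scale T t P \<longleftrightarrow>
     Vector_Spaces.linear scale scale P \<and>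
     (\<forall>v\<in>eigenspace scale T t. P v = v) \<and>
     (\<forall>s\<in>eigenvalues scale T. s \<noteq> t \<longrightarrow> (\<forall>v\<in>eigenspace scale T s. P v = 0))"

definition primitive_idempotents ::
    "(complex \<Rightarrow> 'v::ab_group_add \<Rightarrow> 'v) \<Rightarrow> ('v \<Rightarrow> 'v) \<Rightarrow> ('v \<Rightarrow> 'v) set" where
  "primitive_idempotents scale T = {P. \<exists>t\<in>eigenvalues scale T. eigenprojection scale T t P}"

definition eigenvalue_for ::
    "(complex \<Rightarrow> 'v::ab_group_add \<Rightarrow> 'v) \<Rightarrow> ('v \<Rightarrow> 'v) \<Rightarrow> ('v \<Rightarrow> 'v) \<Rightarrow> complex" where
  "eigenvalue_for scale T P = (THE t. t \<in> eigenvalues scale T \<and> eigenprojection scale T t P)"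

definition leonard_system ::
    "(complex \<Rightarrow> 'v::ab_group_add \<Rightarrow> 'v) \<Rightarrow> nat \<Rightarrow>
     ('v \<Rightarrow> 'v) \<Rightarrow> (nat \<Rightarrow> 'v \<Rightarrow> 'v) \<Rightarrow> ('v \<Rightarrow> 'v) \<Rightarrow> (nat \<Rightarrow> 'v \<Rightarrow> 'v) \<Rightarrow> bool" where
  "leonard_system scale d A E As Es \<longleftrightarrow>
     Vector_Spaces.linear scale scale A \<and> Vector_Spaces.linear scale scale As \<and>
     card (eigenvalues scale A) = d + 1 \<and> card (eigenvalues scale As) = d + 1 \<and>
     bij_betw E {..d} (primitive_idempotents scale A) \<and>
     bij_betw Es {..d} (primitive_idempotents scale As) \<and>
     (\<forall>i\<le>d. \<forall>j\<le>d.
        (\<bar>int i - int j\<bar> > 1 \<longrightarrow> E i \<circ> As \<circ> E j = (\<lambda>_. 0)) \<and>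
        (\<bar>int i - int j\<bar> = 1 \<longrightarrow> E i \<circ> As \<circ> E j \<noteq> (\<lambda>_. 0))) \<and>
     (\<forall>i\<le>d. \<forall>j\<le>d.
        (\<bar>int i - int j\<bar> > 1 \<longrightarrow> Es i \<circ> A \<circ> Es j = (\<lambda>_. 0)) \<and>
        (\<bar>int i - int j\<bar> = 1 \<longrightarrow> Es i \<circ> A \<circ> Es j \<noteq> (\<lambda>_. 0)))"

definition sum_of_ranges :: "(nat \<Rightarrow> 'v::ab_group_add \<Rightarrow> 'v) \<Rightarrow> nat set \<Rightarrow> 'v set" where
  "sum_of_ranges F I = {(\<Sum>j\<in>I. F j (v j)) | v. True}"

definition split_space ::
    "nat \<Rightarrow> (nat \<Rightarrow> 'v::ab_group_add \<Rightarrow> 'v) \<Rightarrow> (nat \<Rightarrow> 'v \<Rightarrow> 'v) \<Rightarrow> nat \<Rightarrow> 'v set" where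
  "split_space d E Es i = sum_of_ranges Es {0..i} \<inter> sum_of_ranges E {i..d}"

definition first_split ::
    "(complex \<Rightarrow> 'v::ab_group_add \<Rightarrow> 'v) \<Rightarrow> nat \<Rightarrow>
     ('v \<Rightarrow> 'v) \<Rightarrow> (nat \<Rightarrow> 'v \<Rightarrow> 'v) \<Rightarrow> ('v \<Rightarrow> 'v) \<Rightarrow> (nat \<Rightarrow> 'v \<Rightarrow> 'v) \<Rightarrow> nat \<Rightarrow> complex" where
  "first_split scale d A E As Es i =
     (THE c. \<forall>u\<in>split_space d E Es i.
        ((\<lambda>v. A v - scale (eigenvalue_for scale A (E (i - 1))) v) \<circ>
         (\<lambda>v. As v - scale (eigenvalue_for scale As (Es i)) v)) u = scale c u)"

definition second_split ::
    "(complex \<Rightarrow> 'v::ab_group_add \<Rightarrow> 'v) \<Rightarrow> nat \<Rightarrow>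
     ('v \<Rightarrow> 'v) \<Rightarrow> (nat \<Rightarrow> 'v \<Rightarrow> 'v) \<Rightarrow> ('v \<Rightarrow> 'v) \<Rightarrow> (nat \<Rightarrow> 'v \<Rightarrow> 'v) \<Rightarrow> nat \<Rightarrow> complex" where
  "second_split scale d A E As Es = first_split scale d A (\<lambda>i. E (d - i)) As Es"

text \<open>The parameters are, in order, \<open>h\<close>, \<open>h\<^sup>*\<close>, \<open>\<kappa>\<close>, \<open>\<kappa>\<^sup>*\<close>, \<open>\<upsilon>\<close>.\<close>

definition dual_q_krawtchouk ::
    "(complex \<Rightarrow> 'v::ab_group_add \<Rightarrow> 'v) \<Rightarrow> complex \<Rightarrow> nat \<Rightarrow>
     ('v \<Rightarrow> 'v) \<Rightarrow> (nat \<Rightarrow> 'v \<Rightarrow> 'v) \<Rightarrow> ('v \<Rightarrow> 'v) \<Rightarrow> (nat \<Rightarrow> 'v \<Rightarrow> 'v) \<Rightarrow>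
     complex \<Rightarrow> complex \<Rightarrow> complex \<Rightarrow> complex \<Rightarrow> complex \<Rightarrow> bool" where
  "dual_q_krawtchouk scale q d A E As Es h hs \<kappa> \<kappa>s \<upsilon> \<longleftrightarrow>
     \<kappa> \<noteq> 0 \<and> \<kappa>s \<noteq> 0 \<and> \<upsilon> \<noteq> 0 \<and>
     (\<forall>i\<le>d. eigenvalue_for scale A (E i)
        = h + \<kappa> * q powi (int d - 2 * int i) + \<upsilon> * q powi (2 * int i - int d)) \<and>
     (\<forall>i\<le>d. eigenvalue_for scale As (Es i) = hs + \<kappa>s * q powi (int d - 2 * int i)) \<and>
     (\<forall>i\<in>{1..d}. first_split scale d A E As Es i
        = \<kappa> * \<kappa>s * q powi (int d + 1 - 2 * int i) * (q powi int i - q powi (- int i))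
            * (q powi (int i - int d - 1) - q powi (int d + 1 - int i))) \<and>
     (\<forall>i\<in>{1..d}. second_split scale d A E As Es i
        = \<kappa>s * \<upsilon> * q powi (int d + 1 - 2 * int i) * (q powi int i - q powi (- int i))
            * (q powi (int i - int d - 1) - q powi (int d + 1 - int i)))"


section \<open>The algebra \<open>U\<^sub>q(sl\<^sub>2)\<close> in the equitable presentation\<close>

text \<open>
  The free \<open>\<complex>\<close>-algebra on a set of generators: finitely supported functions on words, where the
  product is convolution along the factorizations of a word.
\<close>

definition word :: "'g list \<Rightarrow> 'g list \<Rightarrow> complex" where
  "word w = (\<lambda>u. if u = w then 1 else 0)"

definition free_algebra :: "('g list \<Rightarrow> complex) ring" where
  "free_algebra =
     \<lparr>carrier = {f. finite {w. f w \<noteq> 0}},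
      mult = (\<lambda>f g w. \<Sum>i\<le>length w. f (take i w) * g (drop i w)),
      one = word [],
      zero = (\<lambda>_. 0),
      add = (\<lambda>f g w. f w + g w)\<rparr>"

lemma free_algebra_assoc:
  fixes f g h :: "'g list \<Rightarrow> complex"
  shows "(\<Sum>i\<le>length w. (\<Sum>j\<le>length (take i w). f (take j (take i w)) * g (drop j (take i w))) * h (drop i w))
       = (\<Sum>j\<le>length w. f (take j w) * (\<Sum>k\<le>length (drop j w). g (take k (drop j w)) * h (drop k (drop j w))))"
    (is "?L = ?R")
proof -
  let ?n = "length w"
  have "?L = (\<Sum>i\<le>?n. \<Sum>j\<le>i. f (take j w) * g (drop j (take i w)) * h (drop i w))"
    by (intro sum.cong refl) (auto simp: sum_distrib_right min_def intro!: sum.cong)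
  also have "\<dots> = (\<Sum>(i,j)\<in>(SIGMA i:{..?n}. {..i}). f (take j w) * g (drop j (take i w)) * h (drop i w))"
    by (simp add: sum.Sigma)
  also have "\<dots> = (\<Sum>(j,k)\<in>(SIGMA j:{..?n}. {..?n - j}).
                   f (take j w) * (g (take k (drop j w)) * h (drop k (drop j w))))"
    by (rule sum.reindex_bij_witness[where i = "\<lambda>(j,k). (j + k, j)" and j = "\<lambda>(i,j). (j, i - j)"])
       (auto simp: take_drop add.commute)
  also have "\<dots> = ?R"
    by (simp add: sum.Sigma sum_distrib_left)
  finally show ?thesis .
qed

lemma ring_free_algebra: "ring (free_algebra :: ('g list \<Rightarrow> complex) ring)"
proof -
  have fin_add: "finite {w. f w + g w \<noteq> 0}"
    if "finite {w. f w \<noteq> 0}" "finite {w. g w \<noteq> 0}" for f g :: "'g list \<Rightarrow> complex"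
    by (rule finite_subset[of _ "{w. f w \<noteq> 0} \<union> {w. g w \<noteq> 0}"]) (use that in auto)
  have fin_mult: "finite {w. (\<Sum>i\<le>length w. f (take i w) * g (drop i w)) \<noteq> 0}"
    if "finite {w. f w \<noteq> 0}" "finite {w. g w \<noteq> 0}" for f g :: "'g list \<Rightarrow> complex"
  proof (rule finite_subset)
    show "{w. (\<Sum>i\<le>length w. f (take i w) * g (drop i w)) \<noteq> 0}
            \<subseteq> (\<lambda>(u,v). u @ v) ` ({w. f w \<noteq> 0} \<times> {w. g w \<noteq> 0})"
    proof
      fix w assume "w \<in> {w. (\<Sum>i\<le>length w. f (take i w) * g (drop i w)) \<noteq> 0}"
      then obtain i where "f (take i w) * g (drop i w) \<noteq> 0"
        by (auto elim: sum.not_neutral_contains_not_neutral)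
      then show "w \<in> (\<lambda>(u,v). u @ v) ` ({w. f w \<noteq> 0} \<times> {w. g w \<noteq> 0})"
        by (intro image_eqI[of _ _ "(take i w, drop i w)"]) auto
    qed
  qed (use that in auto)
  have fin_one: "finite {w :: 'g list. word [] w \<noteq> 0}"
    by (simp add: word_def)
  have one_left: "(\<Sum>i\<le>length w. word [] (take i w) * f (drop i w)) = f w"
    for f :: "'g list \<Rightarrow> complex" and w
  proof -
    have "(\<Sum>i\<le>length w. word [] (take i w) * f (drop i w)) = (\<Sum>i\<in>{0}. word [] (take i w) * f (drop i w))"
      by (rule sum.mono_neutral_right) (auto simp: word_def)
    then show ?thesis by (simp add: word_def)
  qed
  have one_right: "(\<Sum>i\<le>length w. f (take i w) * word [] (drop i w)) = f w"
    for f :: "'g list \<Rightarrow> complex" and w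
  proof -
    have "(\<Sum>i\<le>length w. f (take i w) * word [] (drop i w)) = (\<Sum>i\<in>{length w}. f (take i w) * word [] (drop i w))"
      by (rule sum.mono_neutral_right) (auto simp: word_def)
    then show ?thesis by (simp add: word_def)
  qed
  show ?thesis
  proof (rule ringI)
    show "abelian_group (free_algebra :: ('g list \<Rightarrow> complex) ring)"
    proof (rule abelian_groupI)
      fix f :: "'g list \<Rightarrow> complex"
      assume "f \<in> carrier free_algebra"
      then show "\<exists>g\<in>carrier free_algebra. g \<oplus>\<^bsub>free_algebra\<^esub> f = \<zero>\<^bsub>free_algebra\<^esub>"
        by (intro bexI[of _ "\<lambda>w. - f w"]) (auto simp: free_algebra_def)
    qed (auto simp: free_algebra_def fin_add algebra_simps)
    show "monoid (free_algebra :: ('g list \<Rightarrow> complex) ring)"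
    proof (rule monoidI)
      fix f g h :: "'g list \<Rightarrow> complex"
      show "f \<otimes>\<^bsub>free_algebra\<^esub> g \<otimes>\<^bsub>free_algebra\<^esub> h = f \<otimes>\<^bsub>free_algebra\<^esub> (g \<otimes>\<^bsub>free_algebra\<^esub> h)"
        unfolding free_algebra_def by (simp only: monoid.simps free_algebra_assoc)
    qed (auto simp: free_algebra_def fin_mult one_left one_right fin_one)
  qed (auto simp: free_algebra_def sum.distrib algebra_simps)
qed

datatype uq_gen = Gen_x | Gen_y | Gen_z | Gen_zinv

definition uq_relators :: "complex \<Rightarrow> (uq_gen list \<Rightarrow> complex) set" where
  "uq_relators q =
     {\<lambda>w. word [Gen_z, Gen_zinv] w - word [] w,
      \<lambda>w. word [Gen_zinv, Gen_z] w - word [] w,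
      \<lambda>w. (q * word [Gen_x, Gen_y] w - inverse q * word [Gen_y, Gen_x] w) / (q - inverse q) - word [] w,
      \<lambda>w. (q * word [Gen_y, Gen_z] w - inverse q * word [Gen_z, Gen_y] w) / (q - inverse q) - word [] w,
      \<lambda>w. (q * word [Gen_z, Gen_x] w - inverse q * word [Gen_x, Gen_z] w) / (q - inverse q) - word [] w}"

definition uq_ideal :: "complex \<Rightarrow> (uq_gen list \<Rightarrow> complex) set" where
  "uq_ideal q = Idl\<^bsub>free_algebra\<^esub> (uq_relators q)"

definition Uq :: "complex \<Rightarrow> (uq_gen list \<Rightarrow> complex) set ring" where
  "Uq q = free_algebra Quot (uq_ideal q)"

definition uq_class :: "complex \<Rightarrow> (uq_gen list \<Rightarrow> complex) \<Rightarrow> (uq_gen list \<Rightarrow> complex) set" where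
  "uq_class q f = uq_ideal q +>\<^bsub>free_algebra\<^esub> f"

definition uq_x :: "complex \<Rightarrow> (uq_gen list \<Rightarrow> complex) set" where
  "uq_x q = uq_class q (word [Gen_x])"

definition uq_y :: "complex \<Rightarrow> (uq_gen list \<Rightarrow> complex) set" where
  "uq_y q = uq_class q (word [Gen_y])"

definition uq_z :: "complex \<Rightarrow> (uq_gen list \<Rightarrow> complex) set" where
  "uq_z q = uq_class q (word [Gen_z])"

text \<open>The image of \<open>c \<in> \<complex>\<close> under the structure map of the \<open>\<complex>\<close>-algebra \<open>U\<^sub>q(sl\<^sub>2)\<close>.\<close>

definition uq_scalar :: "complex \<Rightarrow> complex \<Rightarrow> (uq_gen list \<Rightarrow> complex) set" where
  "uq_scalar q c = uq_class q (\<lambda>w. c * word [] w)"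

text \<open>
  A \<open>U\<^sub>q(sl\<^sub>2)\<close>-module structure on the given complex vector space: the scalars of the algebra act
  through \<open>scale\<close>. The action is extensional, so that two actions are equal iff they agree on
  the algebra.
\<close>

definition uq_module_structure ::
    "(complex \<Rightarrow> 'v::ab_group_add \<Rightarrow> 'v) \<Rightarrow> complex \<Rightarrow>
     ((uq_gen list \<Rightarrow> complex) set \<Rightarrow> 'v \<Rightarrow> 'v) \<Rightarrow> bool" where
  "uq_module_structure scale q act \<longleftrightarrow>
     act \<in> extensional (carrier (Uq q)) \<and>
     (\<forall>a\<in>carrier (Uq q). \<forall>v w. act a (v + w) = act a v + act a w) \<and>
     (\<forall>a\<in>carrier (Uq q). \<forall>b\<in>carrier (Uq q). \<forall>v.
        act (a \<oplus>\<^bsub>Uq q\<^esub> b) v = act a v + act b v \<and>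
        act (a \<otimes>\<^bsub>Uq q\<^esub> b) v = act a (act b v)) \<and>
     (\<forall>v. act \<one>\<^bsub>Uq q\<^esub> v = v) \<and>
     (\<forall>c v. act (uq_scalar q c) v = scale c v)"

end

theory Submission
  imports Defs
begin

text \<open>
  Existence. Fix \<open>v\<close> in \<open>E\<^sup>*\<^sub>0V\<close> and put \<open>u\<^sub>i = (A - \<theta>\<^sub>d\<^sub>-\<^sub>i\<^sub>+\<^sub>1) \<cdots> (A - \<theta>\<^sub>d)v\<close>. These
  vectors are the split basis of the Leonard system with reversed \<open>E\<close>: \<open>A\<close> is lower bidiagonal on it and
  \<open>A\<^sup>*\<close> is upper bidiagonal with the second split sequence above the diagonal. Let \<open>y\<close> act on it diagonally
  by \<open>y u\<^sub>i = \<epsilon>q\<^bsup>2i-d\<^esup>u\<^sub>i\<close>. The equations for \<open>A\<close> and \<open>A\<^sup>*\<close> then dictate \<open>x\<close> and \<open>z\<close>, and the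
  relations reduce to a recurrence for the second split sequence.

  Uniqueness. The operator \<open>z\<close> is determined by \<open>A\<^sup>*\<close>. By the relations, the difference of two candidates for
  \<open>y\<close> maps the \<open>t\<close>-eigenspace of \<open>z\<close> to the \<open>q\<^sup>2t\<close>-eigenspace, and the difference of the candidates for
  \<open>x\<close> maps it to the \<open>q\<^bsup>-2\<^esup>t\<close>-eigenspace. The equation for \<open>A\<close> makes the two differences proportional,
  so they vanish if \<open>q\<^sup>4 \<noteq> 1\<close>. If \<open>q\<^sup>2 = -1\<close>, distinctness of the \<open>\<theta>\<^sup>*\<^sub>i\<close> forces \<open>d \<le> 1\<close>, and for
  \<open>d = 0\<close> the value \<open>q\<^sup>2t\<close> is not an eigenvalue of \<open>z\<close>.
\<close>

section \<open>Eigenspace decompositions\<close>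

locale complex_vector_space = vector_space scale
  for scale :: "complex \<Rightarrow> 'v::ab_group_add \<Rightarrow> 'v"
begin

text \<open>The operator \<open>(T - t (n-1)) ... (T - t 0)\<close>, that is, the Newton basis
  polynomial with nodes \<open>t\<close> evaluated at \<open>T\<close>. It serves twice: to
  annihilate the first \<open>n\<close> eigenvectors of \<open>T\<close>, and to build the split
  basis from a single vector.\<close>

primrec newton_product :: "('v \<Rightarrow> 'v) \<Rightarrow> (nat \<Rightarrow> complex) \<Rightarrow> nat \<Rightarrow> 'v \<Rightarrow> 'v" where
  "newton_product T t 0 v = v"
| "newton_product T t (Suc n) v = T (newton_product T t n v) - scale (t n) (newton_product T t n v)"

lemma linear_newton_product:
  assumes "Vector_Spaces.linear scale scale T"
  shows "Vector_Spaces.linear scale scale (newton_product T t n)"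
proof -
  interpret T: Vector_Spaces.linear scale scale T by fact
  have "newton_product T t n (v + w) = newton_product T t n v + newton_product T t n w" for v w
    by (induction n) (simp_all add: T.add algebra_simps)
  moreover have "newton_product T t n (scale c v) = scale (c) (newton_product T t n v)" for c v
    by (induction n) (simp_all add: T.scale algebra_simps)
  ultimately show ?thesis
    by unfold_locales auto
qed

lemma newton_product_eigenvector:
  assumes "Vector_Spaces.linear scale scale T" "T v = scale s v"
  shows "newton_product T t n v = scale (\<Prod>k<n. s - t k) v"
proof -
  interpret T: Vector_Spaces.linear scale scale T by fact
  show ?thesis
    by (induction n) (simp_all add: T.scale assms(2) algebra_simps)
qed

lemma independent_sequenceI:
  fixes m :: nat
  assumes "\<And>n. n < m \<Longrightarrow> w n \<notin> span (w ` {..<n})"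
  shows "independent (w ` {..<m}) \<and> inj_on w {..<m}"
  using assms
proof (induction m)
  case 0
  then show ?case by (simp add: independent_empty)
next
  case (Suc m)
  have IH: "independent (w ` {..<m})" "inj_on w {..<m}"
    using Suc.IH[OF Suc.prems[OF less_SucI]] by blast+
  have new: "w m \<notin> span (w ` {..<m})" using Suc.prems by blast
  then have "w m \<notin> w ` {..<m}" by (rule contrapos_nn) (rule span_base)
  then have "inj_on w {..<Suc m}"
    using IH(2) by (simp add: lessThan_Suc)
  moreover have "independent (w ` {..<Suc m})"
    unfolding lessThan_Suc image_insert by (rule independent_insertI[OF new IH(1)])
  ultimately show ?case by blast
qed

text \<open>The Newton product with nodes \<open>t 0, ..., t (n-1)\<close> annihilates
  \<open>w 0, ..., w (n-1)\<close>, hence their span, but multiplies \<open>w n\<close> by a product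
  of nonzero differences.\<close>

lemma eigenvector_notin_span:
  fixes n :: nat
  assumes "Vector_Spaces.linear scale scale T"
    and "\<And>k. k \<le> n \<Longrightarrow> T (w k) = scale (t k) (w k)" and "w n \<noteq> 0"
    and "inj_on t {..n}"
  shows "w n \<notin> span (w ` {..<n})"
proof
  assume "w n \<in> span (w ` {..<n})"
  interpret N: Vector_Spaces.linear scale scale "newton_product T t n"
    by (rule linear_newton_product) fact
  have "newton_product T t n v = 0" if "v \<in> span (w ` {..<n})" for v
    using that
  proof (induction rule: span_induct)
    case base
    show ?case using N.subspace_kernel by (simp add: Collect_mono_iff)
  next
    case (step v)
    then obtain k where "k < n" "v = w k" by auto
    then show ?case
      using newton_product_eigenvector[OF assms(1) assms(2), of k t n] by auto
  qed
  then have "scale (\<Prod>k<n. t n - t k) (w n) = 0"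
    using newton_product_eigenvector[OF assms(1) assms(2), of n t n] \<open>w n \<in> _\<close> by simp
  then show False
    using assms(3,4) by (fastforce simp: inj_on_def)
qed

lemma spanning_sequenceI:
  fixes m :: nat
  assumes "dim UNIV = m" "m > 0" "\<And>n. n < m \<Longrightarrow> w n \<notin> span (w ` {..<n})"
  shows "span (w ` {..<m}) = UNIV"
proof -
  obtain B where B: "independent B" "span B = UNIV" "card B = m"
    using basis_exists[of UNIV] assms(1) by (metis UNIV_I subsetI subset_antisym)
  \<comment> \<open>An infinite basis would have cardinality 0 by convention, so
    \<open>m > 0\<close> gives finiteness.\<close>
  then have "finite B" using assms(2) card.infinite by fastforce
  interpret finite_dimensional_vector_space scale B
    using B \<open>finite B\<close> by unfold_locales auto
  have "independent (w ` {..<m})" "inj_on w {..<m}"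
    using independent_sequenceI[OF assms(3)] by auto
  then show ?thesis
    using card_ge_dim_independent[of "w ` {..<m}" UNIV] assms(1) by (auto simp: card_image)
qed

end

text \<open>The working form of a multiplicity-free operator: \<open>w\<close> is a basis of
  eigenvectors of \<open>T\<close>, and \<open>P i\<close> is the projection onto the line of
  \<open>w i\<close> along the other basis vectors. Values at indices above \<open>d\<close> are
  unconstrained.\<close>

locale eigendecomposition = complex_vector_space scale
  for scale :: "complex \<Rightarrow> 'v::ab_group_add \<Rightarrow> 'v" +
  fixes d :: nat and T :: "'v \<Rightarrow> 'v" and P :: "nat \<Rightarrow> 'v \<Rightarrow> 'v"
    and t :: "nat \<Rightarrow> complex" and w :: "nat \<Rightarrow> 'v"
  assumes linear_T: "Vector_Spaces.linear scale scale T"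
    and linear_P: "i \<le> d \<Longrightarrow> Vector_Spaces.linear scale scale (P i)"
    and T_w: "i \<le> d \<Longrightarrow> T (w i) = scale (t i) (w i)"
    and w_nonzero: "i \<le> d \<Longrightarrow> w i \<noteq> 0"
    and inj_t: "inj_on t {..d}"
    and P_w: "i \<le> d \<Longrightarrow> j \<le> d \<Longrightarrow> P i (w j) = (if i = j then w j else 0)"
    and span_w: "span (w ` {..d}) = UNIV"
begin

sublocale T: Vector_Spaces.linear scale scale T by (rule linear_T)

lemma P_add: "i \<le> d \<Longrightarrow> P i (u + v) = P i u + P i v"
  and P_diff: "i \<le> d \<Longrightarrow> P i (u - v) = P i u - P i v"
  and P_scale: "i \<le> d \<Longrightarrow> P i (scale c v) = scale c (P i v)"
  and P_zero: "i \<le> d \<Longrightarrow> P i 0 = 0"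
  and P_sum: "i \<le> d \<Longrightarrow> P i (sum g S) = (\<Sum>x\<in>S. P i (g x))"
  by (metis linear_P linear_iff_module_hom module_hom.add module_hom.diff module_hom.scale
      module_hom.zero module_hom.sum)+

lemma w_induct [case_names w add scale zero]:
  assumes "\<And>i. i \<le> d \<Longrightarrow> Q (w i)" "\<And>u v. Q u \<Longrightarrow> Q v \<Longrightarrow> Q (u + v)"
    "\<And>c v. Q v \<Longrightarrow> Q (scale c v)" "Q 0"
  shows "Q v"
proof -
  have "v \<in> span (w ` {..d})" by (simp add: span_w)
  then show ?thesis
  proof (induction rule: span_induct)
    case base
    show ?case using assms by (auto simp: subspace_def)
  qed (use assms in auto)
qed

lemma sum_P: "(\<Sum>i\<le>d. P i v) = v"
proof (induction v rule: w_induct)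
  case (w j)
  then have "(\<Sum>i\<le>d. P i (w j)) = (\<Sum>i\<le>d. if i = j then w j else 0)"
    by (intro sum.cong) (auto simp: P_w)
  with w show ?case by simp
qed (simp_all add: P_add P_scale P_zero sum.distrib flip: scale_sum_right)

lemma P_eq_scale_w: "i \<le> d \<Longrightarrow> \<exists>c. P i v = scale c (w i)"
proof (induction v rule: w_induct)
  case (w j)
  then show ?case by (auto simp: P_w intro: exI[of _ 0] exI[of _ 1])
next
  case (add u v)
  then show ?case by (metis P_add scale_left_distrib)
next
  case (scale c v)
  then show ?case by (metis P_scale scale_scale)
next
  case zero
  then show ?case by (auto simp: P_zero intro: exI[of _ 0])
qed

lemma P_P: "i \<le> d \<Longrightarrow> j \<le> d \<Longrightarrow> P i (P j v) = (if i = j then P i v else 0)"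
  using P_eq_scale_w[of j v] by (auto simp: P_scale P_w)

lemma T_P: "i \<le> d \<Longrightarrow> T (P i v) = scale (t i) (P i v)"
  using P_eq_scale_w[of i v] by (auto simp: T.scale T_w algebra_simps)

lemma P_T: "i \<le> d \<Longrightarrow> P i (T v) = scale (t i) (P i v)"
proof (induction v rule: w_induct)
  case (w j)
  then show ?case by (auto simp: T_w P_scale P_w)
qed (simp_all add: P_add P_scale P_zero T.add T.scale T.zero algebra_simps)

text \<open>The projections are orthogonal idempotents with sum 1. Membership in a sum of
  eigenspaces thus becomes the vanishing of the remaining components, the form in which split spaces
  are handled below.\<close>

lemma sum_of_ranges_iff:
  assumes "I \<subseteq> {..d}"
  shows "v \<in> sum_of_ranges P I \<longleftrightarrow> (\<forall>k\<in>{..d} - I. P k v = 0)"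
proof
  assume "v \<in> sum_of_ranges P I"
  then obtain g where v: "v = (\<Sum>j\<in>I. P j (g j))" by (auto simp: sum_of_ranges_def)
  show "\<forall>k\<in>{..d} - I. P k v = 0"
  proof
    fix k assume "k \<in> {..d} - I"
    then show "P k v = 0"
      unfolding v using assms by (auto simp: P_sum P_P subset_iff intro!: sum.neutral)
  qed
next
  assume 0: "\<forall>k\<in>{..d} - I. P k v = 0"
  have "(\<Sum>j\<le>d. P j v) = (\<Sum>j\<in>I. P j v)"
    by (rule sum.mono_neutral_right) (use assms 0 in auto)
  then have "v = (\<Sum>j\<in>I. P j v)" by (simp add: sum_P)
  then show "v \<in> sum_of_ranges P I"
    unfolding sum_of_ranges_def by (intro CollectI exI[of _ "\<lambda>_. v"]) simp
qed

end

section \<open>From primitive idempotents to eigendecompositions\<close>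

lemma eigenprojection_unique_eigenvalue:
  assumes "s \<in> eigenvalues scale T" "eigenprojection scale T s P"
    and "t \<in> eigenvalues scale T" "eigenprojection scale T t P"
  shows "s = t"
proof (rule ccontr)
  assume "s \<noteq> t"
  obtain v where "v \<noteq> 0" "v \<in> eigenspace scale T t"
    using assms(3) by (auto simp: eigenvalues_def)
  with \<open>s \<noteq> t\<close> assms(2,3,4) have "P v = 0" "P v = v"
    by (auto simp: eigenprojection_def)
  with \<open>v \<noteq> 0\<close> show False by simp
qed

lemma eigenvalue_for_eqI:
  assumes "t \<in> eigenvalues scale T" "eigenprojection scale T t P"
  shows "eigenvalue_for scale T P = t"
  unfolding eigenvalue_for_def
  using assms eigenprojection_unique_eigenvalue by blast

text \<open>Eigenvectors for \<open>d + 1\<close> distinct eigenvalues span a space of dimension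
  \<open>d + 1\<close>. It remains to match the indexing by idempotents with the
  eigenvalues.\<close>

lemma eigendecompositionI:
  assumes V: "vector_space scale" and dim: "vector_space.dim scale (UNIV :: 'v set) = d + 1"
    and T: "Vector_Spaces.linear scale scale (T :: 'v::ab_group_add \<Rightarrow> 'v)"
    and card: "card (eigenvalues scale T) = d + 1"
    and bij: "bij_betw P {..d} (primitive_idempotents scale T)"
  obtains w where "eigendecomposition scale d T P (\<lambda>i. eigenvalue_for scale T (P i)) w"
proof -
  interpret complex_vector_space scale using V by (simp add: complex_vector_space_def)
  define t where "t i = eigenvalue_for scale T (P i)" for i
  have t: "t i \<in> eigenvalues scale T \<and> eigenprojection scale T (t i) (P i)" if "i \<le> d" for i
  proof -
    have "P i \<in> primitive_idempotents scale T" using bij that by (auto simp: bij_betw_def)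
    then show ?thesis
      using eigenvalue_for_eqI unfolding t_def primitive_idempotents_def by blast
  qed
  \<comment> \<open>An auxiliary enumeration of the eigenvalues, unrelated to \<open>P\<close>. It
    supplies a first eigenbasis \<open>v\<close>, needed to prove that \<open>t\<close> is injective
    before the vectors \<open>w\<close> are known to span.\<close>
  obtain s where s: "bij_betw s {..<d+1} (eigenvalues scale T)"
    using card ex_bij_betw_nat_finite[of "eigenvalues scale T"]
    by (metis atLeast0LessThan card.infinite add_is_0 one_neq_zero)
  have "\<forall>k<d+1. \<exists>v. v \<noteq> 0 \<and> T v = scale (s k) v"
    using s by (auto simp: bij_betw_def eigenvalues_def eigenspace_def)
  then obtain v where v: "\<And>k. k < d+1 \<Longrightarrow> v k \<noteq> 0 \<and> T (v k) = scale (s k) (v k)"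
    by metis
  have span_v: "span (v ` {..<d+1}) = UNIV"
  proof (rule spanning_sequenceI)
    fix n assume n: "n < d + 1"
    have "inj_on s {..n}" by (rule inj_on_subset[OF bij_betw_imp_inj_on[OF s]]) (use n in auto)
    then show "v n \<notin> span (v ` {..<n})"
      by (intro eigenvector_notin_span[OF T, of _ _ s]) (use v n in auto)
  qed (use dim in auto)
  \<comment> \<open>If \<open>t i = t j\<close>, then \<open>P i\<close> and \<open>P j\<close>
    project for the same eigenvalue and agree on the eigenbasis \<open>v\<close>. So they are equal,
    and the bijection gives \<open>i = j\<close>.\<close>
  have inj_t: "inj_on t {..d}"
  proof (rule inj_onI)
    fix i j assume ij: "i \<in> {..d}" "j \<in> {..d}" and eq: "t i = t j"
    have ei: "eigenprojection scale T (t i) (P i)" "eigenprojection scale T (t i) (P j)"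
      using t[of i] t[of j] ij eq by simp_all
    have pair: "module_pair scale scale" by unfold_locales
    have "P i x = P j x" for x
    proof (rule module_pair.module_hom_eq_on_span[OF pair, where f = "P i" and g = "P j" and B = "v ` {..<d+1}"])
      show "module_hom scale scale (P i)" "module_hom scale scale (P j)"
        using ei by (auto simp: eigenprojection_def linear_iff_module_hom)
      fix x assume "x \<in> v ` {..<d+1}"
      then obtain k where k: "k < d+1" "x = v k" by auto
      then have "x \<in> eigenspace scale T (s k)" "s k \<in> eigenvalues scale T"
        using v bij_betw_apply[OF s] by (auto simp: eigenspace_def)
      then show "P i x = P j x"
        using ei unfolding eigenprojection_def by (cases "s k = t i") auto
    qed (use span_v in blast)
    then have "P i = P j" by auto
    then show "i = j" using bij ij by (auto simp: bij_betw_def inj_on_def)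
  qed
  have "\<forall>i\<le>d. \<exists>v. v \<noteq> 0 \<and> T v = scale (t i) v"
    using t by (auto simp: eigenvalues_def eigenspace_def)
  then obtain w where w: "\<And>i. i \<le> d \<Longrightarrow> w i \<noteq> 0 \<and> T (w i) = scale (t i) (w i)"
    by metis
  have "span (w ` {..<d+1}) = UNIV"
  proof (rule spanning_sequenceI)
    fix n assume n: "n < d + 1"
    have "inj_on t {..n}" by (rule inj_on_subset[OF inj_t]) (use n in auto)
    then show "w n \<notin> span (w ` {..<n})"
      by (intro eigenvector_notin_span[OF T, of _ _ t]) (use w n in auto)
  qed (use dim in auto)
  moreover have "P i (w j) = (if i = j then w j else 0)" if "i \<le> d" "j \<le> d" for i j
    using t[OF that(1)] t[OF that(2)] w[OF that(2)] inj_t that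
    unfolding eigenprojection_def eigenspace_def inj_on_def by auto
  ultimately have "eigendecomposition scale d T P t w"
    using T t w inj_t
    by (intro eigendecomposition.intro eigendecomposition_axioms.intro)
      (auto simp: eigenprojection_def lessThan_Suc_atMost intro: complex_vector_space_axioms)
  then show thesis using that unfolding t_def by blast
qed

section \<open>The split basis of a Leonard system\<close>

lemma (in eigendecomposition) P_newton_product:
  assumes "i \<le> d"
  shows "P i (newton_product T s n v) = scale (\<Prod>k<n. t i - s k) (P i v)"
  by (induction n) (simp_all add: assms P_diff P_scale P_T algebra_simps)

text \<open>In terms of flags: \<open>As\<close> maps \<open>E j V + ... + E d V\<close> into the
  sum starting at \<open>j - 1\<close>, while \<open>A\<close> maps
  \<open>Es 0 V + ... + Es j V\<close> into the sum ending at \<open>j + 1\<close> and does reach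
  the new summand.\<close>

locale leonard_decomposition = complex_vector_space scale +
  L: eigendecomposition scale d A E \<theta> w + R: eigendecomposition scale d As Es \<theta>s ws
  for scale :: "complex \<Rightarrow> 'v::ab_group_add \<Rightarrow> 'v"
    and d A E \<theta> w As Es \<theta>s ws +
  assumes E_As_E: "j \<le> d \<Longrightarrow> Suc i < j \<Longrightarrow> E i (As (E j v)) = 0"
    and Es_A_Es: "i \<le> d \<Longrightarrow> Suc j < i \<Longrightarrow> Es i (A (Es j v)) = 0"
    and Es_A_Es_nonzero: "j < d \<Longrightarrow> \<exists>v. Es (Suc j) (A (Es j v)) \<noteq> 0"
begin

text \<open>This vector spans the split space \<open>U_i\<close>: each factor
  \<open>A - \<theta> j\<close> removes the component in \<open>E j V\<close> and extends the
  \<open>Es\<close> flag by one step.\<close>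

definition split_vector :: "nat \<Rightarrow> 'v" where
  "split_vector i = newton_product A \<theta> i (ws 0)"

lemma A_split_vector:
  "A (split_vector i) = scale (\<theta> i) (split_vector i) + split_vector (Suc i)"
  by (simp add: split_vector_def)

lemma Es_A:
  assumes "k \<le> d"
  shows "Es k (A v) = (\<Sum>j\<le>d. Es k (A (Es j v)))"
  using assms by (subst R.sum_P[of v, symmetric]) (simp add: L.T.sum R.P_sum)

lemma E_As:
  assumes "k \<le> d"
  shows "E k (As v) = (\<Sum>j\<le>d. E k (As (E j v)))"
  using assms by (subst L.sum_P[of v, symmetric]) (simp add: R.T.sum L.P_sum)

text \<open>Each application of \<open>A\<close> raises the largest occurring \<open>Es\<close>
  index by at most one, and \<open>ws 0\<close> starts at index 0.\<close>

lemma Es_split_vector_eq_0: "i < k \<Longrightarrow> k \<le> d \<Longrightarrow> Es k (split_vector i) = 0"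
proof (induction i arbitrary: k)
  case 0
  then show ?case by (simp add: split_vector_def R.P_w)
next
  case (Suc i)
  have "Es k (A (Es j (split_vector i))) = 0" if "j \<le> d" for j
  proof (cases "i < j")
    case True
    then show ?thesis
      using Suc that by (simp add: L.T.zero R.P_zero)
  next
    case False
    then show ?thesis using Suc.prems by (intro Es_A_Es) auto
  qed
  then have "Es k (A (split_vector i)) = 0"
    using Es_A[of k "split_vector i"] Suc.prems by simp
  moreover have "Es k (split_vector i) = 0" using Suc by simp
  ultimately show ?case
    using Suc.prems by (simp add: split_vector_def R.P_diff R.P_scale)
qed

text \<open>The component at index \<open>i + 1\<close> can only come from the component at
  \<open>i\<close>, through the block \<open>Es (Suc i) A Es i\<close>. That block is nonzero on a
  one-dimensional space, hence injective there.\<close>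

lemma Es_split_vector_nonzero: "i \<le> d \<Longrightarrow> Es i (split_vector i) \<noteq> 0"
proof (induction i)
  case 0
  then show ?case by (simp add: split_vector_def R.P_w R.w_nonzero)
next
  case (Suc i)
  have "Es (Suc i) (A (Es j (split_vector i))) = 0" if "j \<le> d" "j \<noteq> i" for j
  proof (cases "i < j")
    case True
    then show ?thesis
      using Suc.prems that by (simp add: Es_split_vector_eq_0 L.T.zero R.P_zero)
  next
    case False
    then show ?thesis using Suc.prems that by (intro Es_A_Es) auto
  qed
  then have "(\<Sum>j\<le>d. Es (Suc i) (A (Es j (split_vector i))))
      = (\<Sum>j\<in>{i}. Es (Suc i) (A (Es j (split_vector i))))"
    using Suc.prems by (intro sum.mono_neutral_right) auto
  then have "Es (Suc i) (A (split_vector i)) = Es (Suc i) (A (Es i (split_vector i)))"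
    using Es_A[of "Suc i" "split_vector i"] Suc.prems by simp
  moreover have "Es (Suc i) (split_vector i) = 0"
    using Suc.prems by (intro Es_split_vector_eq_0) auto
  ultimately have *: "Es (Suc i) (split_vector (Suc i)) = Es (Suc i) (A (Es i (split_vector i)))"
    using Suc.prems by (simp add: split_vector_def R.P_diff R.P_scale)
  \<comment> \<open>Both \<open>Es i (split_vector i)\<close> and \<open>Es i v\<close> are
    multiples of \<open>ws i\<close>, so the nonvanishing of the block at some \<open>v\<close>
    passes to \<open>ws i\<close> and from there to the split vector.\<close>
  obtain c where c: "Es i (split_vector i) = scale c (ws i)"
    using R.P_eq_scale_w Suc.prems by (meson Suc_leD)
  then have "c \<noteq> 0" using Suc by auto
  obtain v where v: "Es (Suc i) (A (Es i v)) \<noteq> 0"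
    using Es_A_Es_nonzero Suc.prems by (meson Suc_le_lessD)
  obtain b where "Es i v = scale b (ws i)"
    using R.P_eq_scale_w Suc.prems by (meson Suc_leD)
  with v have "Es (Suc i) (A (ws i)) \<noteq> 0"
    using Suc.prems by (auto simp: L.T.scale R.P_scale)
  then show ?case
    using \<open>c \<noteq> 0\<close> Suc.prems by (simp add: * c L.T.scale R.P_scale)
qed

lemma E_split_vector:
  "k \<le> d \<Longrightarrow> E k (split_vector i) = scale (\<Prod>j<i. \<theta> k - \<theta> j) (E k (ws 0))"
  by (simp add: split_vector_def L.P_newton_product)

lemma E_split_vector_eq_0: "k < i \<Longrightarrow> k \<le> d \<Longrightarrow> E k (split_vector i) = 0"
  by (auto simp: E_split_vector)

text \<open>The product of all \<open>d + 1\<close> factors annihilates every eigenspace of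
  \<open>A\<close>.\<close>

lemma split_vector_Suc_d: "split_vector (Suc d) = 0"
  using L.sum_P[of "split_vector (Suc d)"] by (simp add: E_split_vector_eq_0)

text \<open>Triangularity with respect to the \<open>Es\<close> components: \<open>Es n\<close>
  kills all earlier split vectors but not the one at \<open>n\<close>.\<close>

lemma split_vector_notin_span:
  assumes "n < d + 1"
  shows "split_vector n \<notin> span (split_vector ` {..<n})"
proof
  assume *: "split_vector n \<in> span (split_vector ` {..<n})"
  have "Es n v = 0" if "v \<in> span (split_vector ` {..<n})" for v
    using that
  proof (induction rule: span_induct)
    case base
    show ?case using assms by (auto simp: subspace_def R.P_zero R.P_add R.P_scale)
  next
    case (step v)
    then show ?case using assms by (auto simp: Es_split_vector_eq_0)
  qed
  with * Es_split_vector_nonzero[of n] assms show False by simp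
qed

end

locale finite_leonard_decomposition = leonard_decomposition +
  assumes dim_UNIV: "dim UNIV = d + 1"
begin

lemma span_split_vector: "span (split_vector ` {..<d + 1}) = UNIV"
  using spanning_sequenceI[OF dim_UNIV _ split_vector_notin_span] by simp

lemma split_vector_expansion: "\<exists>a. v = (\<Sum>j\<le>d. scale (a j) (split_vector j))"
proof -
  have "v \<in> span (split_vector ` {..<d + 1})"
    using span_split_vector by blast
  then show ?thesis
  proof (induction rule: span_induct)
    case base
    show ?case
      unfolding subspace_def
    proof (intro conjI ballI allI; clarsimp)
      show "\<exists>a. (\<Sum>j\<le>d. scale (a j) (split_vector j)) = 0"
        by (intro exI[of _ "\<lambda>_. 0"]) simp
      show "\<exists>c. (\<Sum>j\<le>d. scale (a j) (split_vector j)) + (\<Sum>j\<le>d. scale (b j) (split_vector j))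
          = (\<Sum>j\<le>d. scale (c j) (split_vector j))" for a b
        by (intro exI[of _ "\<lambda>j. a j + b j"]) (simp add: sum.distrib scale_left_distrib)
      show "\<exists>b. scale c (\<Sum>j\<le>d. scale (a j) (split_vector j))
          = (\<Sum>j\<le>d. scale (b j) (split_vector j))" for a c
        by (intro exI[of _ "\<lambda>j. c * a j"]) (simp add: scale_sum_right)
    qed
  next
    case (step v)
    then obtain i where i: "i \<le> d" "v = split_vector i"
      by (metis imageE lessThan_iff Suc_eq_plus1 less_Suc_eq_le)
    have "(\<Sum>j\<le>d. scale (if j = i then 1 else 0) (split_vector j))
        = (\<Sum>j\<le>d. if j = i then split_vector j else 0)"
      by (rule sum.cong) auto
    then show ?case
      using i by (intro exI[of _ "\<lambda>j. if j = i then 1 else 0"]) simp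
  qed
qed

text \<open>\<open>E k\<close> commutes with polynomials in \<open>A\<close>, so if it killed
  \<open>ws 0\<close> it would kill every split vector. These span, and \<open>E k\<close> does not
  kill \<open>w k\<close>.\<close>

lemma E_ws_0_nonzero:
  assumes "k \<le> d"
  shows "E k (ws 0) \<noteq> 0"
proof
  assume 0: "E k (ws 0) = 0"
  obtain a where "w k = (\<Sum>j\<le>d. scale (a j) (split_vector j))"
    using split_vector_expansion by blast
  then have "E k (w k) = (\<Sum>j\<le>d. scale (a j) (E k (split_vector j)))"
    using assms by (simp add: L.P_sum L.P_scale)
  also have "\<dots> = 0" using assms 0 by (simp add: E_split_vector)
  finally show False using assms L.w_nonzero by (simp add: L.P_w)
qed

lemma E_split_vector_nonzero:
  assumes "i \<le> d"
  shows "E i (split_vector i) \<noteq> 0"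
proof -
  have "\<theta> i \<noteq> \<theta> j" if "j < i" for j
    using inj_onD[OF L.inj_t, of i j] that assms by auto
  then show ?thesis
    using assms E_ws_0_nonzero by (auto simp: E_split_vector)
qed

lemma mem_split_space_iff:
  "i \<le> d \<Longrightarrow> v \<in> split_space d E Es i \<longleftrightarrow>
     (\<forall>k\<le>d. (i < k \<longrightarrow> Es k v = 0) \<and> (k < i \<longrightarrow> E k v = 0))"
  unfolding split_space_def
  by (auto simp: L.sum_of_ranges_iff R.sum_of_ranges_iff subset_iff)

lemma split_vector_in_split_space: "i \<le> d \<Longrightarrow> split_vector i \<in> split_space d E Es i"
  by (simp add: mem_split_space_iff Es_split_vector_eq_0 E_split_vector_eq_0)

text \<open>The split basis is triangular in two opposite ways. Coefficients below \<open>i\<close>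
  vanish successively from index 0 upwards by applying \<open>E k\<close>, those above
  \<open>i\<close> from index \<open>d\<close> downwards by applying \<open>Es k\<close>.\<close>

lemma split_space_eq_scale:
  assumes "i \<le> d" "v \<in> split_space d E Es i"
  shows "\<exists>c. v = scale c (split_vector i)"
proof -
  obtain a where a: "v = (\<Sum>j\<le>d. scale (a j) (split_vector j))"
    using split_vector_expansion by blast
  have below: "a k = 0" if "k < i" for k
    using that
  proof (induction k rule: less_induct)
    case (less k)
    have "E k v = (\<Sum>j\<le>d. scale (a j) (E k (split_vector j)))"
      unfolding a using less assms by (simp add: L.P_sum L.P_scale)
    also have "\<dots> = (\<Sum>j\<in>{k}. scale (a j) (E k (split_vector j)))"
    proof (rule sum.mono_neutral_right)
      show "\<forall>j\<in>{..d} - {k}. scale (a j) (E k (split_vector j)) = 0"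
      proof
        fix j assume "j \<in> {..d} - {k}"
        then consider "j < k" | "k < j" by fastforce
        then show "scale (a j) (E k (split_vector j)) = 0"
          using less assms by cases (simp_all add: E_split_vector_eq_0)
      qed
    qed (use less assms in auto)
    finally have "scale (a k) (E k (split_vector k)) = 0"
      using less assms by (simp add: mem_split_space_iff)
    then show ?case using E_split_vector_nonzero[of k] less assms by simp
  qed
  have above: "a k = 0" if "i < k" "k \<le> d" for k
    using that
  \<comment> \<open>Induction on \<open>d - k\<close> makes the hypothesis available for the indices
    above \<open>k\<close>.\<close>
  proof (induction "d - k" arbitrary: k rule: less_induct)
    case less
    have "Es k v = (\<Sum>j\<le>d. scale (a j) (Es k (split_vector j)))"
      unfolding a using less assms by (simp add: R.P_sum R.P_scale)
    also have "\<dots> = (\<Sum>j\<in>{k}. scale (a j) (Es k (split_vector j)))"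
    proof (rule sum.mono_neutral_right)
      show "\<forall>j\<in>{..d} - {k}. scale (a j) (Es k (split_vector j)) = 0"
      proof
        fix j assume "j \<in> {..d} - {k}"
        then consider "j < k" | "k < j" "j \<le> d" by fastforce
        then show "scale (a j) (Es k (split_vector j)) = 0"
          using less assms by cases (simp_all add: Es_split_vector_eq_0)
      qed
    qed (use less in auto)
    finally have "scale (a k) (Es k (split_vector k)) = 0"
      using less assms by (simp add: mem_split_space_iff)
    then show ?case using Es_split_vector_nonzero[of k] less assms by simp
  qed
  have "v = (\<Sum>j\<in>{i}. scale (a j) (split_vector j))"
    unfolding a
  proof (rule sum.mono_neutral_right)
    show "\<forall>j\<in>{..d} - {i}. scale (a j) (split_vector j) = 0"
      using below above by (metis Diff_iff atMost_iff insertI1 linorder_neqE_nat scale_zero_left)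
  qed (use assms in auto)
  then show ?thesis by auto
qed

lemma As_split_vector_0: "As (split_vector 0) = scale (\<theta>s 0) (split_vector 0)"
  by (simp add: split_vector_def R.T_w)

text \<open>\<open>As - \<theta>s (Suc i)\<close> sends \<open>U_(i+1)\<close> into the line
  \<open>U_i\<close>, so it produces some multiple \<open>c\<close> of
  \<open>split_vector i\<close>; applying \<open>A - \<theta> i\<close> shows that \<open>c\<close>
  is the split sequence entry. The description by \<open>THE\<close> is spelled out to match the
  unfolded \<open>first_split\<close>.\<close>

lemma As_split_vector_Suc:
  assumes "i < d"
  shows "As (split_vector (Suc i)) = scale (\<theta>s (Suc i)) (split_vector (Suc i)) +
    scale (THE c. \<forall>u\<in>split_space d E Es (Suc i).
        ((\<lambda>v. A v - scale (\<theta> i) v) \<circ> (\<lambda>v. As v - scale (\<theta>s (Suc i)) v)) u = scale c u)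
      (split_vector i)"
proof -
  define x where "x = As (split_vector (Suc i)) - scale (\<theta>s (Suc i)) (split_vector (Suc i))"
  have "x \<in> split_space d E Es i"
  proof (subst mem_split_space_iff; (intro allI impI conjI)?)
    fix k assume k: "k \<le> d"
    \<comment> \<open>The component at \<open>Suc i\<close> is removed by subtracting
      \<open>\<theta>s (Suc i)\<close>; the higher ones were already zero.\<close>
    show "Es k x = 0" if "i < k"
    proof (cases "k = Suc i")
      case True
      then show ?thesis using k by (simp add: x_def R.P_diff R.P_T R.P_scale)
    next
      case False
      then show ?thesis
        using k that by (simp add: x_def R.P_diff R.P_T R.P_scale Es_split_vector_eq_0)
    qed
    show "E k x = 0" if "k < i"
    proof -
      have "E k (As (E j (split_vector (Suc i)))) = 0" if "j \<le> d" for j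
      proof (cases "j < Suc i")
        case True
        then show ?thesis
          using that k by (simp add: E_split_vector_eq_0 R.T.zero L.P_zero)
      next
        case False
        then show ?thesis using \<open>k < i\<close> that by (intro E_As_E) auto
      qed
      then have "E k (As (split_vector (Suc i))) = 0"
        using E_As[of k "split_vector (Suc i)"] k by simp
      then show ?thesis
        using k that by (simp add: x_def L.P_diff L.P_scale E_split_vector_eq_0)
    qed
  qed (use assms in auto)
  then obtain c where c: "x = scale c (split_vector i)"
    using split_space_eq_scale assms by (meson less_imp_le)
  let ?M = "(\<lambda>v. A v - scale (\<theta> i) v) \<circ> (\<lambda>v. As v - scale (\<theta>s (Suc i)) v)"
  \<comment> \<open>\<open>A - \<theta> i\<close> takes \<open>split_vector i\<close> back to
    \<open>split_vector (Suc i)\<close>, so \<open>c\<close> becomes an eigenvalue.\<close>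
  have M: "?M (split_vector (Suc i)) = scale c (split_vector (Suc i))"
    using c by (simp add: x_def[symmetric] L.T.scale A_split_vector algebra_simps)
  have "(THE c. \<forall>u\<in>split_space d E Es (Suc i). ?M u = scale c u) = c"
  proof (rule the_equality)
    show "\<forall>u\<in>split_space d E Es (Suc i). ?M u = scale c u"
    proof
      fix u assume "u \<in> split_space d E Es (Suc i)"
      then obtain b where "u = scale b (split_vector (Suc i))"
        using split_space_eq_scale assms by (meson Suc_leI)
      moreover have "?M (scale b v) = scale b (?M v)" for b v
        by (simp add: L.T.scale R.T.scale L.T.diff algebra_simps)
      ultimately show "?M u = scale c u"
        using M by (simp only: scale_scale mult.commute)
    qed
    fix c' assume "\<forall>u\<in>split_space d E Es (Suc i). ?M u = scale c' u"
    then have "scale c' (split_vector (Suc i)) = scale c (split_vector (Suc i))"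
      using M split_vector_in_split_space assms by (metis Suc_leI)
    moreover have "split_vector (Suc i) \<noteq> 0"
      using Es_split_vector_nonzero[of "Suc i"] assms R.P_zero[of "Suc i"] by auto
    ultimately show "c' = c" by simp
  qed
  then show ?thesis
    using c by (simp add: x_def algebra_simps)
qed

end

section \<open>Reversing the idempotents of \<open>A\<close>, and passage to split bases\<close>

lemma leonard_system_reverse:
  assumes "leonard_system scale d A E As Es"
  shows "leonard_system scale d A (\<lambda>i. E (d - i)) As Es"
proof -
  have "bij_betw (\<lambda>i. d - i) {..d} {..d}"
    by (rule bij_betw_byWitness[where f' = "\<lambda>i. d - i"]) auto
  then have "bij_betw (\<lambda>i. E (d - i)) {..d} (primitive_idempotents scale A)"
    using assms bij_betw_trans[of "\<lambda>i. d - i" "{..d}" "{..d}" E]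
    by (simp add: leonard_system_def comp_def)
  moreover have "int (d - i) - int (d - j) = int j - int i" if "i \<le> d" "j \<le> d" for i j
    using that by simp
  ultimately show ?thesis
    using assms unfolding leonard_system_def by (simp add: abs_minus_commute)
qed

lemma leonard_system_decomposition:
  assumes V: "vector_space scale" and dim: "vector_space.dim scale (UNIV :: 'v set) = d + 1"
    and L: "leonard_system scale d A E As (Es :: nat \<Rightarrow> 'v::ab_group_add \<Rightarrow> 'v)"
  obtains w ws where "finite_leonard_decomposition scale d
    A E (\<lambda>i. eigenvalue_for scale A (E i)) w As Es (\<lambda>i. eigenvalue_for scale As (Es i)) ws"
proof -
  obtain w where w: "eigendecomposition scale d A E (\<lambda>i. eigenvalue_for scale A (E i)) w"
    using eigendecompositionI[OF V dim] L unfolding leonard_system_def by metis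
  obtain ws where ws: "eigendecomposition scale d As Es (\<lambda>i. eigenvalue_for scale As (Es i)) ws"
    using eigendecompositionI[OF V dim] L unfolding leonard_system_def by metis
  have E0: "E i \<circ> As \<circ> E j = (\<lambda>_. 0)" if "j \<le> d" "Suc i < j" for i j
    using L that unfolding leonard_system_def by auto
  have Es0: "Es i \<circ> A \<circ> Es j = (\<lambda>_. 0)" if "i \<le> d" "Suc j < i" for i j
    using L that unfolding leonard_system_def by auto
  have Es1: "Es (Suc j) \<circ> A \<circ> Es j \<noteq> (\<lambda>_. 0)" if "j < d" for j
    using L that unfolding leonard_system_def by auto
  have "leonard_decomposition scale d
      A E (\<lambda>i. eigenvalue_for scale A (E i)) w As Es (\<lambda>i. eigenvalue_for scale As (Es i)) ws"
  proof (intro leonard_decomposition.intro leonard_decomposition_axioms.intro)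
    show "E i (As (E j v)) = 0" if "j \<le> d" "Suc i < j" for i j v
      using fun_cong[OF E0[OF that], of v] by simp
    show "Es i (A (Es j v)) = 0" if "i \<le> d" "Suc j < i" for i j v
      using fun_cong[OF Es0[OF that], of v] by simp
    show "\<exists>v. Es (Suc j) (A (Es j v)) \<noteq> 0" if "j < d" for j
      using Es1[OF that] by (auto simp: fun_eq_iff)
  qed (use w ws V in \<open>auto simp: complex_vector_space_def\<close>)
  then show thesis
    using that dim
    by (simp add: finite_leonard_decomposition_def finite_leonard_decomposition_axioms_def)
qed

section \<open>Modules over the free algebra and over \<open>U\<^sub>q(sl\<^sub>2)\<close>\<close>

primrec word_op :: "('g \<Rightarrow> 'v \<Rightarrow> 'v) \<Rightarrow> 'g list \<Rightarrow> 'v \<Rightarrow> 'v" where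
  "word_op G [] v = v"
| "word_op G (g # u) v = G g (word_op G u v)"

lemma word_op_append: "word_op G (u @ u') v = word_op G u (word_op G u' v)"
  by (induction u) auto

lemma free_algebra_simps:
  "carrier free_algebra = {f. finite {w. f w \<noteq> 0}}"
  "\<one>\<^bsub>free_algebra\<^esub> = word []"
  "\<zero>\<^bsub>free_algebra\<^esub> = (\<lambda>_. 0)"
  "f \<oplus>\<^bsub>free_algebra\<^esub> g = (\<lambda>w. f w + g w)"
  "f \<otimes>\<^bsub>free_algebra\<^esub> g = (\<lambda>w. \<Sum>i\<le>length w. f (take i w) * g (drop i w))"
  by (simp_all add: free_algebra_def)

text \<open>The cut positions of a word correspond bijectively to its factorizations. Indexing by
  pairs from the supports makes products of sums easy to regroup.\<close>

lemma free_algebra_mult_eq_sum_factorizations: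
  assumes "{w. f w \<noteq> 0} \<subseteq> F" "{w. g w \<noteq> 0} \<subseteq> H" "finite F" "finite H"
  shows "(f \<otimes>\<^bsub>free_algebra\<^esub> g) w = (\<Sum>p | p \<in> F \<times> H \<and> fst p @ snd p = w. f (fst p) * g (snd p))"
proof -
  let ?s = "\<lambda>i. (take i w, drop i w)"
  have inj: "inj_on ?s {..length w}"
    by (rule inj_on_inverseI[where g = "\<lambda>p. length (fst p)"]) auto
  have "(f \<otimes>\<^bsub>free_algebra\<^esub> g) w = (\<Sum>p\<in>?s ` {..length w}. f (fst p) * g (snd p))"
    by (simp add: free_algebra_simps sum.reindex[OF inj])
  also have "\<dots> = (\<Sum>p | p \<in> F \<times> H \<and> fst p @ snd p = w. f (fst p) * g (snd p))"
  proof (rule sum.mono_neutral_right)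
    show "{p. p \<in> F \<times> H \<and> fst p @ snd p = w} \<subseteq> ?s ` {..length w}"
    proof
      fix p assume "p \<in> {p. p \<in> F \<times> H \<and> fst p @ snd p = w}"
      then show "p \<in> ?s ` {..length w}"
        by (intro image_eqI[of _ _ "length (fst p)"]) auto
    qed
  qed (use assms in auto)
  finally show ?thesis .
qed

lemma word_mult: "word u \<otimes>\<^bsub>free_algebra\<^esub> word u' = word (u @ u')"
proof
  fix w
  have "(word u \<otimes>\<^bsub>free_algebra\<^esub> word u') w
      = (\<Sum>p | p \<in> {u} \<times> {u'} \<and> fst p @ snd p = w. word u (fst p) * word u' (snd p))"
    by (rule free_algebra_mult_eq_sum_factorizations) (auto simp: word_def)
  also have "{p. p \<in> {u} \<times> {u'} \<and> fst p @ snd p = w} = (if u @ u' = w then {(u, u')} else {})"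
    by auto
  finally show "(word u \<otimes>\<^bsub>free_algebra\<^esub> word u') w = word (u @ u') w"
    by (simp add: word_def)
qed

lemma scalar_mult:
  fixes f :: "'g list \<Rightarrow> complex"
  assumes "f \<in> carrier free_algebra"
  shows "(\<lambda>w. c * word [] w) \<otimes>\<^bsub>free_algebra\<^esub> f = (\<lambda>w. c * f w)"
proof
  fix w :: "'g list"
  interpret ring "free_algebra :: ('g list \<Rightarrow> complex) ring" by (rule ring_free_algebra)
  have "(\<one>\<^bsub>free_algebra\<^esub> \<otimes>\<^bsub>free_algebra\<^esub> f) w = f w"
    using assms by simp
  then show "((\<lambda>w. c * word [] w) \<otimes>\<^bsub>free_algebra\<^esub> f) w = c * f w"
    by (simp add: free_algebra_simps mult.assoc flip: sum_distrib_left)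
qed

lemma word_in_free_algebra: "word u \<in> carrier free_algebra"
  by (simp add: free_algebra_simps word_def)

lemma scaled_in_free_algebra:
  "f \<in> carrier free_algebra \<Longrightarrow> (\<lambda>w. c * f w) \<in> carrier free_algebra"
  by (auto simp: free_algebra_simps elim!: rev_finite_subset)

lemma add_in_free_algebra:
  "f \<in> carrier free_algebra \<Longrightarrow> g \<in> carrier free_algebra \<Longrightarrow> (\<lambda>w. f w + g w) \<in> carrier free_algebra"
  using ring.ring_simprules(1)[OF ring_free_algebra, of f g] by (simp add: free_algebra_simps)

lemma free_algebra_induct [consumes 1, case_names zero add]:
  fixes f :: "'g list \<Rightarrow> complex"
  assumes "f \<in> carrier free_algebra"
    and zero: "Q (\<lambda>_. 0)"
    and add: "\<And>c u f. f \<in> carrier free_algebra \<Longrightarrow> Q f \<Longrightarrow> Q (\<lambda>w. c * word u w + f w)"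
  shows "Q f"
proof -
  have "finite {w. f w \<noteq> 0}" using assms(1) by (simp add: free_algebra_simps)
  then show ?thesis
  proof (induction "{w. f w \<noteq> 0}" arbitrary: f rule: finite_induct)
    case empty
    then have "f = (\<lambda>_. 0)" by auto
    then show ?case using zero by simp
  next
    case (insert u S)
    define g where "g = f(u := 0)"
    have g: "S = {w. g w \<noteq> 0}" using insert.hyps(2,4) by (auto simp: g_def)
    then have "Q g" "g \<in> carrier free_algebra"
      using insert.hyps(1,3) by (auto simp: free_algebra_simps)
    then have "Q (\<lambda>w. f u * word u w + g w)" by (intro add)
    also have "(\<lambda>w. f u * word u w + g w) = f"
      by (auto simp: g_def word_def)
    finally show ?case .
  qed
qed

context complex_vector_space
begin

text \<open>The extension of an assignment of operators to the generators to the whole free algebra,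
  as in its universal property.\<close>

definition free_act :: "('g \<Rightarrow> 'v \<Rightarrow> 'v) \<Rightarrow> ('g list \<Rightarrow> complex) \<Rightarrow> 'v \<Rightarrow> 'v" where
  "free_act G f v = (\<Sum>w | f w \<noteq> 0. scale (f w) (word_op G w v))"

text \<open>Allows sums over different supports to be compared over one common finite set of
  words.\<close>

lemma free_act_superset:
  assumes "finite F" "{w. f w \<noteq> 0} \<subseteq> F"
  shows "free_act G f v = (\<Sum>w\<in>F. scale (f w) (word_op G w v))"
  unfolding free_act_def by (rule sum.mono_neutral_left) (use assms in auto)

lemma free_act_zero: "free_act G (\<lambda>_. 0) v = 0"
  by (simp add: free_act_def)

lemma free_act_word: "free_act G (word u) v = word_op G u v"
  by (subst free_act_superset[of "{u}"]) (auto simp: word_def)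

lemma free_act_add:
  assumes "f \<in> carrier free_algebra" "g \<in> carrier free_algebra"
  shows "free_act G (\<lambda>w. f w + g w) v = free_act G f v + free_act G g v"
proof -
  define F where "F = {w. f w \<noteq> 0} \<union> {w. g w \<noteq> 0}"
  have "finite F" using assms by (simp add: F_def free_algebra_simps)
  then show ?thesis
    by (subst (1 2 3) free_act_superset[of F]) (auto simp: F_def scale_left_distrib sum.distrib)
qed

lemma free_act_scale:
  assumes "f \<in> carrier free_algebra"
  shows "free_act G (\<lambda>w. c * f w) v = scale c (free_act G f v)"
  using assms
  by (subst (1 2) free_act_superset[of "{w. f w \<noteq> 0}"])
    (auto simp: free_algebra_simps scale_sum_right)

lemma linear_word_op:
  assumes "\<And>g. Vector_Spaces.linear scale scale (G g)"
  shows "Vector_Spaces.linear scale scale (word_op G u)"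
proof (induction u)
  case Nil
  show ?case using linear_id by (simp add: id_def)
next
  case (Cons g u)
  have "word_op G (g # u) = G g \<circ> word_op G u" by auto
  then show ?case using Vector_Spaces.linear_compose[OF Cons assms[of g]] by metis
qed

lemma linear_free_act:
  assumes "\<And>g. Vector_Spaces.linear scale scale (G g)"
  shows "Vector_Spaces.linear scale scale (free_act G f)"
proof -
  have W: "module_hom scale scale (word_op G u)" for u
    using linear_word_op[OF assms] by (simp add: linear_iff_module_hom)
  have "free_act G f (v + v') = free_act G f v + free_act G f v'" for v v'
    by (simp add: free_act_def module_hom.add[OF W] scale_right_distrib sum.distrib)
  moreover have "free_act G f (scale c v) = scale c (free_act G f v)" for c v
    by (simp add: free_act_def module_hom.scale[OF W] scale_sum_right mult.commute)
  ultimately show ?thesis by unfold_locales auto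
qed

text \<open>Expanding the product gives a sum over pairs of words grouped by their concatenation.
  Ungrouping it and using that concatenation acts as composition gives the iterated action.\<close>

lemma free_act_mult:
  assumes G: "\<And>g. Vector_Spaces.linear scale scale (G g)"
    and "f \<in> carrier free_algebra" "g \<in> carrier free_algebra"
  shows "free_act G (f \<otimes>\<^bsub>free_algebra\<^esub> g) v = free_act G f (free_act G g v)"
proof -
  define F where "F = {w. f w \<noteq> 0}"
  define H where "H = {w. g w \<noteq> 0}"
  define S where "S = (\<lambda>p. fst p @ snd p) ` (F \<times> H)"
  have fin: "finite F" "finite H" "finite S"
    using assms by (auto simp: F_def H_def S_def free_algebra_simps)
  have W: "module_hom scale scale (word_op G u)" for u
    using linear_word_op[OF G] by (simp add: linear_iff_module_hom)
  have mult: "(f \<otimes>\<^bsub>free_algebra\<^esub> g) w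
      = (\<Sum>p | p \<in> F \<times> H \<and> fst p @ snd p = w. f (fst p) * g (snd p))" for w
    by (rule free_algebra_mult_eq_sum_factorizations) (use fin in \<open>auto simp: F_def H_def\<close>)
  have "free_act G (f \<otimes>\<^bsub>free_algebra\<^esub> g) v
      = (\<Sum>w\<in>S. scale ((f \<otimes>\<^bsub>free_algebra\<^esub> g) w) (word_op G w v))"
  proof (rule free_act_superset[OF fin(3)])
    show "{w. (f \<otimes>\<^bsub>free_algebra\<^esub> g) w \<noteq> 0} \<subseteq> S"
      unfolding mult S_def by (fastforce elim!: sum.not_neutral_contains_not_neutral)
  qed
  also have "\<dots> = (\<Sum>w\<in>S. \<Sum>p | p \<in> F \<times> H \<and> fst p @ snd p = w.
      scale (f (fst p) * g (snd p)) (word_op G (fst p @ snd p) v))"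
    unfolding mult scale_sum_left by (intro sum.cong refl) auto
  also have "\<dots> = (\<Sum>p\<in>F \<times> H. scale (f (fst p) * g (snd p)) (word_op G (fst p @ snd p) v))"
    by (rule sum.group) (use fin in \<open>auto simp: S_def\<close>)
  also have "\<dots> = (\<Sum>a\<in>F. \<Sum>b\<in>H. scale (f a * g b) (word_op G (a @ b) v))"
    by (simp add: sum.cartesian_product case_prod_beta)
  also have "\<dots> = free_act G f (free_act G g v)"
    by (simp add: free_act_def F_def[symmetric] H_def[symmetric] module_hom.sum[OF W]
        module_hom.scale[OF W] scale_sum_right word_op_append)
  finally show ?thesis .
qed

end

section \<open>The quotient by the relators\<close>

lemma uq_relators_in_free_algebra: "uq_relators q \<subseteq> carrier free_algebra"
proof -
  have "finite {w. a * word u w + b * word u' w + c * word u'' w \<noteq> 0}"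
    for a b c and u u' u'' :: "uq_gen list"
    by (rule finite_subset[of _ "{u, u', u''}"]) (auto simp: word_def split: if_splits)
  \<comment> \<open>Every relator is a combination of at most three words; coefficient 0 covers the
    two relators for the inverse of \<open>z\<close>.\<close>
  from this[of 1 _ "-1" _ 0] this[of "q / (q - inverse q)" _ "- inverse q / (q - inverse q)" _ "-1"]
  show ?thesis
    by (auto simp: uq_relators_def free_algebra_simps diff_divide_distrib)
qed

lemma ideal_uq_ideal: "ideal (uq_ideal q) free_algebra"
  unfolding uq_ideal_def
  by (rule ring.genideal_ideal[OF ring_free_algebra uq_relators_in_free_algebra])

lemma ring_Uq: "ring (Uq q)"
  unfolding Uq_def by (rule ideal.quotient_is_ring[OF ideal_uq_ideal])

lemma uq_class_hom: "uq_class q \<in> ring_hom free_algebra (Uq q)"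
  using ideal.rcos_ring_hom[OF ideal_uq_ideal] by (simp add: uq_class_def[abs_def] Uq_def)

lemma uq_class_surj:
  assumes "a \<in> carrier (Uq q)"
  obtains f where "f \<in> carrier free_algebra" "a = uq_class q f"
  using assms by (auto simp: Uq_def FactRing_def A_RCOSETS_def' uq_class_def)

lemma uq_class_ideal:
  assumes "r \<in> uq_ideal q"
  shows "uq_class q r = \<zero>\<^bsub>Uq q\<^esub>"
proof -
  interpret ideal "uq_ideal q" free_algebra by (rule ideal_uq_ideal)
  show ?thesis using a_rcos_const[OF assms] by (simp add: uq_class_def Uq_def FactRing_def)
qed

lemma uq_class_eqD:
  assumes "f \<in> carrier free_algebra" "g \<in> carrier free_algebra" "uq_class q f = uq_class q g"
  obtains r where "r \<in> uq_ideal q" "f = (\<lambda>w. r w + g w)"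
proof -
  interpret ideal "uq_ideal q" free_algebra by (rule ideal_uq_ideal)
  have "f \<in> uq_class q g" using a_rcos_self[OF assms(1)] assms(3) by (simp add: uq_class_def)
  then show thesis
    using that by (auto simp: uq_class_def a_r_coset_def' free_algebra_simps)
qed

lemma uq_class_closed: "f \<in> carrier free_algebra \<Longrightarrow> uq_class q f \<in> carrier (Uq q)"
  using uq_class_hom by (rule ring_hom_closed)

lemma uq_class_word_append: "uq_class q (word (u @ u')) = uq_class q (word u) \<otimes>\<^bsub>Uq q\<^esub> uq_class q (word u')"
  using ring_hom_mult[OF uq_class_hom word_in_free_algebra word_in_free_algebra, of q u u']
  by (simp add: word_mult)

lemma uq_class_scale:
  "f \<in> carrier free_algebra \<Longrightarrow> uq_class q (\<lambda>w. c * f w) = uq_scalar q c \<otimes>\<^bsub>Uq q\<^esub> uq_class q f"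
  using ring_hom_mult[OF uq_class_hom scaled_in_free_algebra[OF word_in_free_algebra], of f q c "[]"]
  by (simp add: scalar_mult uq_scalar_def)

lemma uq_class_add:
  "f \<in> carrier free_algebra \<Longrightarrow> g \<in> carrier free_algebra \<Longrightarrow>
    uq_class q (\<lambda>w. f w + g w) = uq_class q f \<oplus>\<^bsub>Uq q\<^esub> uq_class q g"
  using ring_hom_add[OF uq_class_hom, of f g q] by (simp add: free_algebra_simps)

lemma mult_scalar:
  fixes f :: "'g list \<Rightarrow> complex"
  assumes "f \<in> carrier free_algebra"
  shows "f \<otimes>\<^bsub>free_algebra\<^esub> (\<lambda>w. c * word [] w) = (\<lambda>w. c * f w)"
proof
  fix w :: "'g list"
  interpret ring "free_algebra :: ('g list \<Rightarrow> complex) ring" by (rule ring_free_algebra)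
  have "(f \<otimes>\<^bsub>free_algebra\<^esub> \<one>\<^bsub>free_algebra\<^esub>) w = f w"
    using assms by simp
  then show "(f \<otimes>\<^bsub>free_algebra\<^esub> (\<lambda>w. c * word [] w)) w = c * f w"
    by (simp add: free_algebra_simps mult.left_commute flip: sum_distrib_left)
qed

text \<open>Module structures are only required to be additive in the vector; centrality of the
  scalars is what makes each element act homogeneously.\<close>

lemma uq_scalar_commute:
  assumes "a \<in> carrier (Uq q)"
  shows "a \<otimes>\<^bsub>Uq q\<^esub> uq_scalar q c = uq_scalar q c \<otimes>\<^bsub>Uq q\<^esub> a"
proof -
  obtain f where f: "f \<in> carrier free_algebra" "a = uq_class q f"
    using assms by (rule uq_class_surj)
  then show ?thesis
    using ring_hom_mult[OF uq_class_hom f(1) scaled_in_free_algebra[OF word_in_free_algebra], of q c "[]"]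
    by (simp add: mult_scalar uq_class_scale flip: uq_scalar_def)
qed

context complex_vector_space
begin

definition uq_relations :: "complex \<Rightarrow> (uq_gen \<Rightarrow> 'v \<Rightarrow> 'v) \<Rightarrow> bool" where
  "uq_relations q G \<longleftrightarrow> (\<forall>v.
     G Gen_z (G Gen_zinv v) = v \<and> G Gen_zinv (G Gen_z v) = v \<and>
     scale q (G Gen_x (G Gen_y v)) - scale (inverse q) (G Gen_y (G Gen_x v)) = scale (q - inverse q) v \<and>
     scale q (G Gen_y (G Gen_z v)) - scale (inverse q) (G Gen_z (G Gen_y v)) = scale (q - inverse q) v \<and>
     scale q (G Gen_z (G Gen_x v)) - scale (inverse q) (G Gen_x (G Gen_z v)) = scale (q - inverse q) v)"

lemma free_act_trinomial:
  "free_act G (\<lambda>w. a * word u w + b * word u' w + c * word u'' w) v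
    = scale a (word_op G u v) + scale b (word_op G u' v) + scale c (word_op G u'' v)"
  by (simp add: free_act_add free_act_scale free_act_word add_in_free_algebra
      scaled_in_free_algebra word_in_free_algebra)

text \<open>Since \<open>q\<^sup>2 \<noteq> 1\<close>, the denominator \<open>q - inverse q\<close>
  is invertible, so clearing it loses nothing.\<close>

lemma uq_relations_iff:
  assumes "q \<noteq> 0" "q\<^sup>2 \<noteq> 1"
  shows "uq_relations q G \<longleftrightarrow> (\<forall>r\<in>uq_relators q. \<forall>v. free_act G r v = 0)"
proof -
  have nz: "q - inverse q \<noteq> 0"
    using assms by (simp add: field_simps power2_eq_square)
  have binom: "free_act G (\<lambda>w. word u w - word [] w) v = word_op G u v - v" for u v
    using free_act_trinomial[of G 1 u "-1" "[]" 0 "[]" v] by simp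
  have qcomm: "free_act G (\<lambda>w. (q * word u w - inverse q * word u' w) / (q - inverse q) - word [] w) v
      = scale (inverse (q - inverse q))
          (scale q (word_op G u v) - scale (inverse q) (word_op G u' v)) - v" for u u' v
    using free_act_trinomial[of G "q / (q - inverse q)" u "- (inverse q / (q - inverse q))" u' "-1" "[]" v]
    by (simp add: diff_divide_distrib scale_right_diff_distrib field_simps)
  have inv: "scale (inverse (q - inverse q)) x - v = 0 \<longleftrightarrow> x = scale (q - inverse q) v" for x v
    using nz by auto
  show ?thesis
    unfolding uq_relations_def uq_relators_def ball_simps binom qcomm inv by auto
qed

text \<open>Multiplicativity fixes the action of words, and additivity together with the scalars
  fixes that of their combinations. Hence two module structures agree once their generators act
  alike.\<close>

lemma uq_module_determined:
  assumes act: "uq_module_structure scale q act"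
  defines "G \<equiv> \<lambda>g. act (uq_class q (word [g]))"
  shows "Vector_Spaces.linear scale scale (G g)"
    and "f \<in> carrier free_algebra \<Longrightarrow> act (uq_class q f) v = free_act G f v"
    and "r \<in> uq_relators q \<Longrightarrow> free_act G r v = 0"
proof -
  have add: "act a (v + w) = act a v + act a w" if "a \<in> carrier (Uq q)" for a v w
    using act that by (simp add: uq_module_structure_def)
  have act_add: "act (a \<oplus>\<^bsub>Uq q\<^esub> b) v = act a v + act b v"
    and act_mult: "act (a \<otimes>\<^bsub>Uq q\<^esub> b) v = act a (act b v)"
    if "a \<in> carrier (Uq q)" "b \<in> carrier (Uq q)" for a b v
    using act that by (simp_all add: uq_module_structure_def)
  have act_one: "act \<one>\<^bsub>Uq q\<^esub> v = v" and act_scalar: "act (uq_scalar q c) v = scale c v" for c v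
    using act by (simp_all add: uq_module_structure_def)
  have scalar: "uq_scalar q c \<in> carrier (Uq q)" for c
    unfolding uq_scalar_def by (intro uq_class_closed scaled_in_free_algebra word_in_free_algebra)
  have word: "uq_class q (word u) \<in> carrier (Uq q)" for u
    by (intro uq_class_closed word_in_free_algebra)
  have act_zero: "act \<zero>\<^bsub>Uq q\<^esub> v = 0" for v
  proof -
    have Z: "\<zero>\<^bsub>Uq q\<^esub> \<in> carrier (Uq q)"
      by (rule ring.ring_simprules(2)[OF ring_Uq])
    from act_add[OF Z Z, of v] show ?thesis
      using ring.ring_simprules(8)[OF ring_Uq Z] by simp
  qed
  have "act a (scale c v) = scale c (act a v)" if "a \<in> carrier (Uq q)" for a c v
    using act_mult[OF that scalar, of c v] act_mult[OF scalar that, of c v]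
    by (simp add: uq_scalar_commute[OF that] act_scalar)
  with add word show "Vector_Spaces.linear scale scale (G g)"
    unfolding G_def by unfold_locales auto
  have act_word: "act (uq_class q (word u)) v = word_op G u v" for u v
  proof (induction u)
    case Nil
    then show ?case
      using act_one ring_hom_one[OF uq_class_hom, of q] by (simp add: free_algebra_simps)
  next
    case (Cons g u)
    then show ?case
      using uq_class_word_append[of q "[g]" u] act_mult[OF word word] by (simp add: G_def)
  qed
  show act_free: "act (uq_class q f) v = free_act G f v" if "f \<in> carrier free_algebra" for f v
    using that
  proof (induction rule: free_algebra_induct)
    case zero
    have "uq_class q (\<lambda>_. 0) = \<zero>\<^bsub>Uq q\<^esub>"
      using uq_class_scale[OF word_in_free_algebra, of q 0 "[]"]
        ring_hom_zero[OF uq_class_hom ring_free_algebra ring_Uq] by (simp add: free_algebra_simps)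
    then show ?case by (simp add: act_zero free_act_zero)
  next
    case (add c u f)
    then show ?case
      by (simp add: uq_class_add uq_class_scale scaled_in_free_algebra word_in_free_algebra
          act_add act_mult scalar word act_scalar act_word uq_class_closed
          ring.ring_simprules(5)[OF ring_Uq] free_act_add free_act_scale free_act_word)
  qed
  show "free_act G r v = 0" if "r \<in> uq_relators q"
  proof -
    have "r \<in> uq_ideal q"
      unfolding uq_ideal_def
      using ring.genideal_self[OF ring_free_algebra uq_relators_in_free_algebra] that by blast
    then show ?thesis
      using act_free[of r v] uq_relators_in_free_algebra[of q] that
      by (auto simp: uq_class_ideal act_zero)
  qed
qed

text \<open>The elements acting as zero form a two-sided ideal \<open>K\<close>; it contains the
  relators, hence the ideal they generate.\<close>

lemma free_act_uq_ideal:
  assumes G: "\<And>g. Vector_Spaces.linear scale scale (G g)"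
    and rel: "\<forall>r\<in>uq_relators q. \<forall>v. free_act G r v = 0"
    and "f \<in> uq_ideal q"
  shows "free_act G f v = 0"
proof -
  define K where "K = {f \<in> carrier free_algebra. \<forall>v. free_act G f v = 0}"
  interpret F: ring "free_algebra :: (uq_gen list \<Rightarrow> complex) ring" by (rule ring_free_algebra)
  have act0: "free_act G f 0 = 0" for f
    using linear_free_act[of G f, OF G] by (simp add: linear_iff_module_hom module_hom.zero)
  have neg: "\<ominus>\<^bsub>free_algebra\<^esub> f = (\<lambda>w. (-1) * f w)" if "f \<in> carrier free_algebra"
    for f :: "uq_gen list \<Rightarrow> complex"
    by (rule F.minus_equality)
      (use that scaled_in_free_algebra[OF that, of "-1"] in \<open>auto simp: free_algebra_simps\<close>)
  have "ideal K free_algebra"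
  proof (rule idealI)
    show "ring (free_algebra :: (uq_gen list \<Rightarrow> complex) ring)" by (rule ring_free_algebra)
    show "subgroup K (add_monoid free_algebra)"
    proof (rule F.add.subgroupI)
      show "K \<subseteq> carrier free_algebra" by (auto simp: K_def)
      have "(\<lambda>_. 0) \<in> K" using F.zero_closed by (simp add: K_def free_algebra_simps free_act_zero)
      then show "K \<noteq> {}" by blast
      show "\<ominus>\<^bsub>free_algebra\<^esub> f \<in> K" if "f \<in> K" for f
        using that by (simp only: K_def mem_Collect_eq neg free_act_scale scaled_in_free_algebra) simp
      show "f \<oplus>\<^bsub>free_algebra\<^esub> g \<in> K" if "f \<in> K" "g \<in> K" for f g
        using that F.a_closed[of f g] by (simp add: K_def free_algebra_simps(4) free_act_add)
    qed
    show "g \<otimes>\<^bsub>free_algebra\<^esub> f \<in> K" "f \<otimes>\<^bsub>free_algebra\<^esub> g \<in> K"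
      if "f \<in> K" "g \<in> carrier free_algebra" for f g
      using that by (simp_all add: K_def free_act_mult[OF G] act0)
  qed
  moreover have "uq_relators q \<subseteq> K"
    using rel uq_relators_in_free_algebra by (auto simp: K_def)
  ultimately have "uq_ideal q \<subseteq> K"
    unfolding uq_ideal_def by (rule F.genideal_minimal)
  with assms(3) show ?thesis by (auto simp: K_def)
qed

lemma uq_module_exists:
  assumes G: "\<And>g. Vector_Spaces.linear scale scale (G g)"
    and rel: "\<forall>r\<in>uq_relators q. \<forall>v. free_act G r v = 0"
  obtains act where "uq_module_structure scale q act" "\<And>g. act (uq_class q (word [g])) = G g"
proof -
  \<comment> \<open>Each class acts through a chosen representative. Two representatives differ by
    an element of the ideal, which acts as zero, so the choice does not matter.\<close>
  define act where "act = restrict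
    (\<lambda>a. free_act G (SOME f. f \<in> carrier free_algebra \<and> uq_class q f = a)) (carrier (Uq q))"
  have act: "act (uq_class q f) v = free_act G f v" if f: "f \<in> carrier free_algebra" for f v
  proof -
    define g where "g = (SOME g. g \<in> carrier free_algebra \<and> uq_class q g = uq_class q f)"
    have g: "g \<in> carrier free_algebra \<and> uq_class q g = uq_class q f"
      unfolding g_def by (rule someI[of _ f]) (use f in auto)
    then obtain r where r: "r \<in> uq_ideal q" "g = (\<lambda>w. r w + f w)"
      using uq_class_eqD f by metis
    interpret ideal "uq_ideal q" free_algebra by (rule ideal_uq_ideal)
    have "free_act G g v = free_act G f v"
      using free_act_add[of r f G v] r f Icarr[OF r(1)] free_act_uq_ideal[OF G rel r(1)] by simp
    then show ?thesis
      using uq_class_closed[OF f, of q] by (simp add: act_def g_def)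
  qed
  have lin: "module_hom scale scale (free_act G f)" for f
    using linear_free_act[OF G] by (simp add: linear_iff_module_hom)
  have "uq_module_structure scale q act"
    unfolding uq_module_structure_def
  proof (intro conjI ballI allI)
    show "act \<in> extensional (carrier (Uq q))" by (simp add: act_def)
    show "act a (v + w) = act a v + act a w" if "a \<in> carrier (Uq q)" for a v w
      using that module_hom.add[OF lin] by (metis act uq_class_surj)
    show "act (a \<oplus>\<^bsub>Uq q\<^esub> b) v = act a v + act b v"
      "act (a \<otimes>\<^bsub>Uq q\<^esub> b) v = act a (act b v)"
      if ab: "a \<in> carrier (Uq q)" "b \<in> carrier (Uq q)" for a b v
    proof -
      obtain f g where f: "f \<in> carrier free_algebra" "a = uq_class q f"
        and g: "g \<in> carrier free_algebra" "b = uq_class q g"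
        using ab by (metis uq_class_surj)
      show "act (a \<oplus>\<^bsub>Uq q\<^esub> b) v = act a v + act b v"
        using f g by (simp add: act free_act_add add_in_free_algebra flip: uq_class_add)
      show "act (a \<otimes>\<^bsub>Uq q\<^esub> b) v = act a (act b v)"
        using f g ring.ring_simprules(5)[OF ring_free_algebra f(1) g(1)]
        by (simp add: act free_act_mult[OF G] flip: ring_hom_mult[OF uq_class_hom])
    qed
    show "act \<one>\<^bsub>Uq q\<^esub> v = v" for v
      using act[OF word_in_free_algebra, of "[]" v] ring_hom_one[OF uq_class_hom, of q]
      by (simp add: free_act_word free_algebra_simps)
    show "act (uq_scalar q c) v = scale c v" for c v
      by (simp add: uq_scalar_def act free_act_scale free_act_word word_in_free_algebra
          scaled_in_free_algebra)
  qed
  moreover have "act (uq_class q (word [g])) = G g" for g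
    by (rule ext) (simp add: act word_in_free_algebra free_act_word)
  ultimately show thesis by (rule that)
qed

end

section \<open>The equitable relations on the split basis\<close>

context complex_vector_space
begin

text \<open>Both sides are linear in \<open>v\<close>, so a spanning set suffices.\<close>

lemma q_commutator_eqI:
  assumes F: "Vector_Spaces.linear scale scale F" and H: "Vector_Spaces.linear scale scale H"
    and span: "span S = UNIV"
    and S: "\<And>s. s \<in> S \<Longrightarrow> scale a (F (H s)) - scale b (H (F s)) = scale c s"
  shows "scale a (F (H v)) - scale b (H (F v)) = scale c v"
proof -
  interpret F: Vector_Spaces.linear scale scale F by fact
  interpret H: Vector_Spaces.linear scale scale H by fact
  have "v \<in> span S" using span by simp
  then show ?thesis
  proof (induction rule: span_induct)
    case base
    have "scale a (F (H (v + w))) - scale b (H (F (v + w))) = scale c (v + w)"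
      if "scale a (F (H v)) - scale b (H (F v)) = scale c v"
        "scale a (F (H w)) - scale b (H (F w)) = scale c w" for v w
      unfolding scale_right_distrib that[symmetric] by (simp add: F.add H.add algebra_simps)
    moreover have "scale a (F (H (scale k v))) - scale b (H (F (scale k v))) = scale c (scale k v)"
      if "scale a (F (H v)) - scale b (H (F v)) = scale c v" for k v
    proof -
      have "scale c (scale k v) = scale k (scale c v)" by (simp add: mult.commute)
      then show ?thesis
        unfolding that[symmetric] by (simp add: F.scale H.scale algebra_simps)
    qed
    ultimately show ?case
      by (auto simp: subspace_def F.zero H.zero)
  qed (use S in auto)
qed

text \<open>
  \<open>m\<close> and \<open>n\<close> are the eigenvalue sequences \<open>\<epsilon>q\<^bsup>2i-d\<^esup>\<close> and \<open>\<epsilon>q\<^bsup>d-2i\<^esup>\<close>,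
  and \<open>\<beta>\<close> is the second split sequence divided by \<open>\<kappa>\<^sup>*\<upsilon>\<close>.
\<close>

lemma equitable_relations_on_split_basis:
  fixes u :: "nat \<Rightarrow> 'v" and m n \<beta> :: "nat \<Rightarrow> complex"
  assumes q: "q \<noteq> 0"
    and X: "Vector_Spaces.linear scale scale X"
    and Y: "Vector_Spaces.linear scale scale Y"
    and Z: "Vector_Spaces.linear scale scale Z"
    and span: "span (u ` {..<d + 1}) = UNIV" and u_end: "u (Suc d) = 0"
    and Y_u: "\<And>i. i \<le> d \<Longrightarrow> Y (u i) = scale (m i) (u i)"
    and X_u: "\<And>i. i \<le> d \<Longrightarrow> X (u i) = scale (n i) (u i) + scale a (u (Suc i))"
    and Z_u: "\<And>i. i \<le> d \<Longrightarrow> Z (u i) = scale (n i) (u i) + scale (b * \<beta> i) (u (i - 1))"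
    and ab: "a * b = 1"
    and mn: "\<And>i. m i * n i = 1" and m_Suc: "\<And>i. m (Suc i) = q\<^sup>2 * m i"
    and \<beta>_0: "\<beta> 0 = 0" and \<beta>_end: "\<beta> (Suc d) = 0"
    and \<beta>_rec: "\<And>i. q * \<beta> (Suc i) - inverse q * \<beta> i = (q - inverse q) * (1 - (n i)\<^sup>2)"
  shows "scale q (X (Y v)) - scale (inverse q) (Y (X v)) = scale (q - inverse q) v"
    and "scale q (Y (Z v)) - scale (inverse q) (Z (Y v)) = scale (q - inverse q) v"
    and "scale q (Z (X v)) - scale (inverse q) (X (Z v)) = scale (q - inverse q) v"
proof -
  interpret X: Vector_Spaces.linear scale scale X by fact
  interpret Y: Vector_Spaces.linear scale scale Y by fact
  interpret Z: Vector_Spaces.linear scale scale Z by fact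
  have n_Suc: "n i = q\<^sup>2 * n (Suc i)" for i
  proof -
    have "n i = n i * (m (Suc i) * n (Suc i))" by (simp add: mn)
    also have "\<dots> = q\<^sup>2 * (m i * n i) * n (Suc i)" by (simp add: m_Suc)
    finally show ?thesis by (simp add: mn)
  qed
  \<comment> \<open>The assumption on \<open>Y\<close> stops at index \<open>d\<close>; at
    \<open>i = d\<close> both sides are zero because \<open>u (Suc d) = 0\<close>.\<close>
  have Y_Suc: "Y (u (Suc i)) = scale (q\<^sup>2 * m i) (u (Suc i))" if "i \<le> d" for i
    using Y_u[of "Suc i"] that u_end by (cases "i = d") (auto simp: Y.zero m_Suc)
  have Z_Suc: "Z (u (Suc i)) = scale (n (Suc i)) (u (Suc i)) + scale (b * \<beta> (Suc i)) (u i)"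
    if "i \<le> d" for i
    using Z_u[of "Suc i"] that u_end by (cases "i = d") (auto simp: Z.zero \<beta>_end)
  \<comment> \<open>Each commutator sends \<open>u i\<close> to a combination of
    \<open>u (i - 1)\<close>, \<open>u i\<close> and \<open>u (Suc i)\<close>: the outer
    coefficients must vanish and the middle one must match. A summand \<open>scale 0 0\<close> fills
    an absent slot.\<close>
  have combine: "scale x r + scale y s + scale z t = scale y' s"
    if "x = 0" "y = y'" "z = 0" for x y z y' and r s t :: 'v
    using that by simp
  have lincomb: "scale a (scale x r + scale y s + scale z t)
      - scale b (scale x' r + scale y' s + scale z' t)
      = scale (a * x - b * x') r + scale (a * y - b * y') s + scale (a * z - b * z') t"
    for a b x y z x' y' z' and r s t :: 'v
    by (simp add: algebra_simps)
  note expand = scale_right_distrib scale_left_distrib scale_right_diff_distrib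
    scale_left_diff_distrib scale_scale
  show "scale q (X (Y v)) - scale (inverse q) (Y (X v)) = scale (q - inverse q) v"
  proof (rule q_commutator_eqI[OF X Y span])
    fix s assume "s \<in> u ` {..<d + 1}"
    then obtain i where i: "i \<le> d" and s: "s = u i"
      by (metis imageE lessThan_iff Suc_eq_plus1 less_Suc_eq_le)
    have "scale q (X (Y s)) - scale (inverse q) (Y (X s)) = scale 0 0
      + scale (q * (m i * n i) - inverse q * (m i * n i)) (u i)
      + scale (q * m i * a - inverse q * a * (q\<^sup>2 * m i)) (u (Suc i))"
      using i by (simp add: s X_u Y_u Y_Suc X.scale Y.scale Y.add expand algebra_simps)
    also have "\<dots> = scale (q - inverse q) (u i)"
      by (rule combine) (use q in \<open>simp_all add: mn power2_eq_square\<close>)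
    finally show "scale q (X (Y s)) - scale (inverse q) (Y (X s)) = scale (q - inverse q) s"
      by (simp add: s)
  qed
  show "scale q (Y (Z v)) - scale (inverse q) (Z (Y v)) = scale (q - inverse q) v"
  proof (rule q_commutator_eqI[OF Y Z span])
    fix s assume "s \<in> u ` {..<d + 1}"
    then obtain i where i: "i \<le> d" and s: "s = u i"
      by (metis imageE lessThan_iff Suc_eq_plus1 less_Suc_eq_le)
    have "scale q (Y (Z s)) - scale (inverse q) (Z (Y s))
      = scale (q * (b * \<beta> i) * m (i - 1) - inverse q * m i * (b * \<beta> i)) (u (i - 1))
      + scale (q * (m i * n i) - inverse q * (m i * n i)) (u i) + scale 0 0"
      using i by (simp add: s Z_u Y_u Y.scale Z.scale Y.add expand algebra_simps)
    also have "\<dots> = scale (q - inverse q) (u i)"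
    proof (rule combine)
      show "q * (b * \<beta> i) * m (i - 1) - inverse q * m i * (b * \<beta> i) = 0"
        using q by (cases i) (simp_all add: \<beta>_0 m_Suc power2_eq_square)
    qed (simp_all add: mn)
    finally show "scale q (Y (Z s)) - scale (inverse q) (Z (Y s)) = scale (q - inverse q) s"
      by (simp add: s)
  qed
  show "scale q (Z (X v)) - scale (inverse q) (X (Z v)) = scale (q - inverse q) v"
  proof (rule q_commutator_eqI[OF Z X span])
    fix s assume "s \<in> u ` {..<d + 1}"
    then obtain i where i: "i \<le> d" and s: "s = u i"
      by (metis imageE lessThan_iff Suc_eq_plus1 less_Suc_eq_le)
    \<comment> \<open>At \<open>i = 0\<close> the truncated index \<open>i - 1\<close> is a dummy,
      made harmless by \<open>\<beta> 0 = 0\<close>.\<close>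
    have X_pred: "scale (b * \<beta> i) (X (u (i - 1)))
        = scale (b * \<beta> i * n (i - 1)) (u (i - 1)) + scale (a * b * \<beta> i) (u i)"
      using i by (cases i) (simp_all add: \<beta>_0 X_u expand mult_ac)
    have ZX: "Z (X s) = scale (n i * (b * \<beta> i)) (u (i - 1))
        + scale ((n i)\<^sup>2 + a * b * \<beta> (Suc i)) (u i) + scale (a * n (Suc i)) (u (Suc i))"
      using i by (simp add: s Z_u X_u Z_Suc Z.scale Z.add expand power2_eq_square mult_ac add_ac)
    have XZ: "X (Z s) = scale (b * \<beta> i * n (i - 1)) (u (i - 1))
        + scale ((n i)\<^sup>2 + a * b * \<beta> i) (u i) + scale (a * n i) (u (Suc i))"
      using i X_pred
      by (simp add: s Z_u X_u X.scale X.add expand power2_eq_square mult_ac add_ac)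
    have "scale q (Z (X s)) - scale (inverse q) (X (Z s))
      = scale (q * (n i * (b * \<beta> i)) - inverse q * (b * \<beta> i * n (i - 1))) (u (i - 1))
      + scale (q * ((n i)\<^sup>2 + a * b * \<beta> (Suc i)) - inverse q * ((n i)\<^sup>2 + a * b * \<beta> i)) (u i)
      + scale (q * (a * n (Suc i)) - inverse q * (a * n i)) (u (Suc i))"
      unfolding ZX XZ by (rule lincomb)
    also have "\<dots> = scale (q - inverse q) (u i)"
    proof (rule combine)
      show "q * (n i * (b * \<beta> i)) - inverse q * (b * \<beta> i * n (i - 1)) = 0"
        using q n_Suc[of "i - 1"] by (cases i) (simp_all add: \<beta>_0 power2_eq_square)
      show "q * (a * n (Suc i)) - inverse q * (a * n i) = 0"
        using q by (simp add: n_Suc[of i] power2_eq_square)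
      \<comment> \<open>Only this diagonal coefficient of the third relation uses
        \<open>a * b = 1\<close> and the recurrence for \<open>\<beta>\<close>.\<close>
      have "q * ((n i)\<^sup>2 + a * b * \<beta> (Suc i)) - inverse q * ((n i)\<^sup>2 + a * b * \<beta> i)
        = (q - inverse q) * (n i)\<^sup>2 + (q * \<beta> (Suc i) - inverse q * \<beta> i)"
        by (simp add: ab algebra_simps)
      then show "q * ((n i)\<^sup>2 + a * b * \<beta> (Suc i)) - inverse q * ((n i)\<^sup>2 + a * b * \<beta> i)
        = q - inverse q"
        unfolding \<beta>_rec by (simp add: algebra_simps)
    qed
    finally show "scale q (Z (X s)) - scale (inverse q) (X (Z s)) = scale (q - inverse q) s"
      by (simp add: s)
  qed
qed

lemma diagonal_operator_exists:
  fixes u :: "nat \<Rightarrow> 'v"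
  assumes "\<And>n. n < k \<Longrightarrow> u n \<notin> span (u ` {..<n})"
  obtains Y where "Vector_Spaces.linear scale scale Y" "\<And>i. i < k \<Longrightarrow> Y (u i) = scale (m i) (u i)"
proof -
  have ind: "independent (u ` {..<k})" and inj: "inj_on u {..<k}"
    using independent_sequenceI[OF assms] by auto
  interpret vector_space_pair scale scale by unfold_locales
  obtain Y where "Vector_Spaces.linear scale scale Y"
    "\<forall>x\<in>u ` {..<k}. Y x = scale (m (the_inv_into {..<k} u x)) x"
    using linear_independent_extend[OF ind, of "\<lambda>x. scale (m (the_inv_into {..<k} u x)) x"] by blast
  then show thesis
    using that the_inv_into_f_f[OF inj] by auto
qed

text \<open>The right-hand sides of the relations are the same for both structures and cancel in the
  difference, leaving homogeneous \<open>q\<close>-commutation relations with \<open>z\<close>. The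
  second conclusion keeps \<open>q\<^sup>2\<close> on the left to avoid a division.\<close>

lemma equitable_difference_eigenvector:
  assumes q: "q \<noteq> 0"
    and G: "\<And>g. Vector_Spaces.linear scale scale (G g)" "uq_relations q G"
    and G': "\<And>g. Vector_Spaces.linear scale scale (G' g)" "uq_relations q G'"
    and z: "G Gen_z = G' Gen_z" and v: "G Gen_z v = scale t v"
  shows "G Gen_z (G Gen_y v - G' Gen_y v) = scale (q\<^sup>2 * t) (G Gen_y v - G' Gen_y v)"
    and "scale (q\<^sup>2) (G Gen_z (G Gen_x v - G' Gen_x v)) = scale t (G Gen_x v - G' Gen_x v)"
proof -
  interpret z: Vector_Spaces.linear scale scale "G Gen_z" by (rule G(1))
  note lin = G(1)[unfolded linear_iff_module_hom, THEN module_hom.scale]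
    G'(1)[unfolded linear_iff_module_hom, THEN module_hom.scale]
  have y: "scale q (scale t (G Gen_y v)) - scale (inverse q) (G Gen_z (G Gen_y v)) = scale (q - inverse q) v"
    "scale q (scale t (G' Gen_y v)) - scale (inverse q) (G Gen_z (G' Gen_y v)) = scale (q - inverse q) v"
    using G(2) G'(2) v z by (metis uq_relations_def lin)+
  have "scale (inverse q) (G Gen_z (G Gen_y v - G' Gen_y v)) = scale (q * t) (G Gen_y v - G' Gen_y v)"
    using y(1)[folded y(2)] by (simp add: z.diff scale_right_diff_distrib algebra_simps)
  then have "scale q (scale (inverse q) (G Gen_z (G Gen_y v - G' Gen_y v)))
      = scale q (scale (q * t) (G Gen_y v - G' Gen_y v))"
    by (rule arg_cong)
  then show "G Gen_z (G Gen_y v - G' Gen_y v) = scale (q\<^sup>2 * t) (G Gen_y v - G' Gen_y v)"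
    using q by (simp add: power2_eq_square mult.assoc)
  have x: "scale q (G Gen_z (G Gen_x v)) - scale (inverse q) (scale t (G Gen_x v)) = scale (q - inverse q) v"
    "scale q (G Gen_z (G' Gen_x v)) - scale (inverse q) (scale t (G' Gen_x v)) = scale (q - inverse q) v"
    using G(2) G'(2) v z by (metis uq_relations_def lin)+
  have "scale q (G Gen_z (G Gen_x v - G' Gen_x v)) = scale (inverse q * t) (G Gen_x v - G' Gen_x v)"
    using x(1)[folded x(2)] by (simp add: z.diff scale_right_diff_distrib algebra_simps)
  then have "scale q (scale q (G Gen_z (G Gen_x v - G' Gen_x v)))
      = scale q (scale (inverse q * t) (G Gen_x v - G' Gen_x v))"
    by (rule arg_cong)
  then show "scale (q\<^sup>2) (G Gen_z (G Gen_x v - G' Gen_x v)) = scale t (G Gen_x v - G' Gen_x v)"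
    using q by (simp add: power2_eq_square flip: mult.assoc)
qed

end

section \<open>The recurrence for the normalized split sequence\<close>

definition split_coefficient :: "complex \<Rightarrow> nat \<Rightarrow> nat \<Rightarrow> complex" where
  "split_coefficient q d i = q powi (int d + 1 - 2 * int i) * (q powi int i - q powi (- int i))
     * (q powi (int i - int d - 1) - q powi (int d + 1 - int i))"

lemma split_coefficient_0: "split_coefficient q d 0 = 0"
  and split_coefficient_Suc_d: "split_coefficient q d (Suc d) = 0"
  by (simp_all add: split_coefficient_def)

text \<open>Written in \<open>Q = q^i\<close> and \<open>D = q^d\<close>, the integer powers become
  rational expressions, and the recurrence can be checked by field arithmetic.\<close>

lemma split_coefficient_eq:
  assumes "q \<noteq> 0"
  shows "split_coefficient q d i = 1 - (q powi int d)\<^sup>2 * q\<^sup>2 / (q powi int i)\<^sup>2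
    - 1 / (q powi int i)\<^sup>2 + (q powi int d)\<^sup>2 * q\<^sup>2 / (q powi int i) ^ 4"
proof -
  define Q D where "Q = q powi int i" and "D = q powi int d"
  have nz: "Q \<noteq> 0" "D \<noteq> 0" using assms by (simp_all add: Q_def D_def)
  have "q powi (int i + int i) = Q\<^sup>2"
    using assms by (subst power_int_add) (auto simp: Q_def power2_eq_square)
  then have "q powi (2 * int i) = Q\<^sup>2" by (simp only: mult_2)
  then have p1: "q powi (int d + 1 - 2 * int i) = D * q / Q\<^sup>2"
    using assms by (simp add: power_int_diff power_int_add D_def)
  have p2: "q powi (- int i) = 1 / Q" by (simp add: Q_def power_int_minus field_simps)
  have p3: "q powi (int i - int d - 1) = Q / (D * q)"
    using assms by (simp add: power_int_diff Q_def D_def)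
  have p4: "q powi (int d + 1 - int i) = D * q / Q"
    using assms by (simp add: power_int_diff power_int_add Q_def D_def)
  show ?thesis
    unfolding split_coefficient_def p1 p2 p3 p4 unfolding Q_def[symmetric] D_def[symmetric]
    using nz assms by (simp add: field_simps power2_eq_square power4_eq_xxxx)
qed

lemma split_coefficient_rec:
  assumes "q \<noteq> 0"
  shows "q * split_coefficient q d (Suc i) - inverse q * split_coefficient q d i
    = (q - inverse q) * (1 - (q powi (int d - 2 * int i))\<^sup>2)"
proof -
  define Q D where "Q = q powi int i" and "D = q powi int d"
  have nz: "Q \<noteq> 0" "D \<noteq> 0" using assms by (simp_all add: Q_def D_def)
  have "q powi (int i + int i) = Q\<^sup>2"
    using assms by (subst power_int_add) (auto simp: Q_def power2_eq_square)
  then have "q powi (2 * int i) = Q\<^sup>2" by (simp only: mult_2)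
  then have p1: "q powi (int d - 2 * int i) = D / Q\<^sup>2"
    using assms by (simp add: power_int_diff D_def)
  have p2: "q powi (int (Suc i)) = q * Q"
    using assms unfolding Q_def by (simp add: power_int_add)
  show ?thesis
    unfolding split_coefficient_eq[OF assms] p1 p2 unfolding Q_def[symmetric] D_def[symmetric]
    using nz assms by (simp add: field_simps power2_eq_square power4_eq_xxxx)
qed

theorem theorem1p5:
  fixes scale :: "complex \<Rightarrow> 'v::ab_group_add \<Rightarrow> 'v"
    and q h hs \<kappa> \<kappa>s \<upsilon> \<epsilon> :: complex
    and d :: nat
    and A As :: "'v \<Rightarrow> 'v"
    and E Es :: "nat \<Rightarrow> 'v \<Rightarrow> 'v"
(* The third assumption excludes the one case in which uniqueness fails: if d = 1 and q^2 = -1,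
   the relations are symmetric under transposing the off-diagonal entries of x and y, and
   two different module structures satisfy the equations for A and A*. *)
  assumes "q \<noteq> 0" and "q\<^sup>2 \<noteq> 1"
    and "\<not> (d = 1 \<and> q\<^sup>2 = -1)"
    and "vector_space scale" and "vector_space.dim scale (UNIV :: 'v set) = d + 1"
    and "leonard_system scale d A E As Es"
    and "dual_q_krawtchouk scale q d A E As Es h hs \<kappa> \<kappa>s \<upsilon>"
    and "\<epsilon> \<in> {1, -1}"
  shows "\<exists>!act. uq_module_structure scale q act \<and>
           (\<forall>v. A v = scale h v + scale (\<epsilon> * \<kappa>) (act (uq_y q) v) + scale (\<epsilon> * \<upsilon>) (act (uq_x q) v)) \<and>
           (\<forall>v. As v = scale hs v + scale (\<epsilon> * \<kappa>s) (act (uq_z q) v))"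
proof -
  have q: "q \<noteq> 0" and \<epsilon>: "\<epsilon> * \<epsilon> = 1" using assms(1,8) by auto
  have \<epsilon>_nz: "\<epsilon> \<noteq> 0" using \<epsilon> by auto
  have \<epsilon>_cancel: "\<epsilon> * (\<epsilon> * c) = c" for c using \<epsilon> by (simp flip: mult.assoc)
  have \<epsilon>_cancel2: "\<epsilon> * b * (\<epsilon> * c) = b * c" for b c using \<epsilon>_cancel[of "b * c"] by (simp add: mult_ac)
  have nz: "\<kappa> \<noteq> 0" "\<kappa>s \<noteq> 0" "\<upsilon> \<noteq> 0"
    using assms(7) by (auto simp: dual_q_krawtchouk_def)
  define n m where "n i = \<epsilon> * q powi (int d - 2 * int i)"
    and "m i = \<epsilon> * q powi (2 * int i - int d)" for i
  have mn: "m i * n i = 1" for i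
  proof -
    have "m i * n i = (\<epsilon> * \<epsilon>) * (q powi (2 * int i - int d) * q powi (int d - 2 * int i))"
      unfolding m_def n_def by (simp only: mult_ac)
    also have "\<dots> = 1" unfolding \<epsilon> using q by (simp flip: power_int_add)
    finally show ?thesis .
  qed
  have n_nz: "n i \<noteq> 0" for i using mn[of i] by auto
  have m_Suc: "m (Suc i) = q\<^sup>2 * m i" for i
  proof -
    have "q powi (2 * int (Suc i) - int d) = q powi (2 + (2 * int i - int d))"
      by (simp add: algebra_simps)
    also have "\<dots> = q\<^sup>2 * q powi (2 * int i - int d)"
      using q by (subst power_int_add) auto
    finally show ?thesis by (simp add: m_def)
  qed

  \<comment> \<open>The system is reversed because the first split sequence of the reversed system
    is the second split sequence of the given one.\<close>
  obtain w ws where "finite_leonard_decomposition scale d A (\<lambda>i. E (d - i))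
      (\<lambda>i. eigenvalue_for scale A (E (d - i))) w As Es (\<lambda>i. eigenvalue_for scale As (Es i)) ws"
    using leonard_system_decomposition[OF assms(4,5) leonard_system_reverse[OF assms(6)]] by metis
  then interpret D: finite_leonard_decomposition scale d A "\<lambda>i. E (d - i)"
    "\<lambda>i. eigenvalue_for scale A (E (d - i))" w As Es "\<lambda>i. eigenvalue_for scale As (Es i)" ws .
  \<comment> \<open>Replacing \<open>i\<close> by \<open>d - i\<close> exchanges the two exponents;
    the factors \<open>\<epsilon>\<close> are absorbed by
    \<open>\<epsilon> * \<epsilon> = 1\<close>.\<close>
  have A_eigenvalue: "eigenvalue_for scale A (E (d - i)) = h + \<epsilon> * \<kappa> * m i + \<epsilon> * \<upsilon> * n i"
    if "i \<le> d" for i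
  proof -
    have "eigenvalue_for scale A (E (d - i)) = h + \<kappa> * q powi (int d - 2 * int (d - i))
        + \<upsilon> * q powi (2 * int (d - i) - int d)"
      using assms(7) by (simp add: dual_q_krawtchouk_def)
    also have "\<dots> = h + \<kappa> * q powi (2 * int i - int d) + \<upsilon> * q powi (int d - 2 * int i)"
      using that by (simp add: of_nat_diff algebra_simps)
    finally show ?thesis
      by (simp add: m_def n_def \<epsilon>_cancel2)
  qed
  have As_eigenvalue: "eigenvalue_for scale As (Es i) = hs + \<epsilon> * \<kappa>s * n i" if "i \<le> d" for i
    using assms(7) that
    by (simp add: dual_q_krawtchouk_def n_def \<epsilon>_cancel2)
  let ?u = D.split_vector
  have A_u: "A (?u i) = scale (h + \<epsilon> * \<kappa> * m i + \<epsilon> * \<upsilon> * n i) (?u i) + ?u (Suc i)"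
    if "i \<le> d" for i
    using D.A_split_vector[of i] A_eigenvalue that by simp
  \<comment> \<open>For \<open>i = 0\<close> the index \<open>i - 1\<close> is again 0, but the
    coefficient vanishes there, so one formula covers all \<open>i\<close>.\<close>
  have As_u: "As (?u i) = scale (hs + \<epsilon> * \<kappa>s * n i) (?u i)
      + scale (\<kappa>s * \<upsilon> * split_coefficient q d i) (?u (i - 1))" if "i \<le> d" for i
  proof (cases i)
    case 0
    then show ?thesis
      using D.As_split_vector_0 As_eigenvalue[of 0] by (simp add: split_coefficient_0)
  next
    case (Suc k)
    have "i \<in> {1..d}" using Suc that by simp
    then have "second_split scale d A E As Es i = \<kappa>s * \<upsilon> * split_coefficient q d i"
      using assms(7) unfolding dual_q_krawtchouk_def split_coefficient_def mult.assoc by blast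
    then show ?thesis
      using D.As_split_vector_Suc[of k] that As_eigenvalue[of i] Suc
      by (simp add: second_split_def first_split_def)
  qed

  obtain Y where Y: "Vector_Spaces.linear scale scale Y"
    and Y_u: "\<And>i. i < d + 1 \<Longrightarrow> Y (?u i) = scale (m i) (?u i)"
    using D.diagonal_operator_exists[OF D.split_vector_notin_span] by blast
  interpret Y: Vector_Spaces.linear scale scale Y by (rule Y)
  \<comment> \<open>\<open>X\<close> and \<open>Z\<close> are obtained by solving the required
    equations for \<open>x\<close> and \<open>z\<close>, with \<open>\<epsilon>\<close> as its own
    inverse. The inverse of \<open>Z\<close> is defined spectrally: \<open>Z\<close> is
    \<open>n i\<close> on the range of \<open>Es i\<close>, and \<open>m i\<close> is the reciprocal
    of \<open>n i\<close>.\<close>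
  define X where "X v = scale (\<epsilon> / \<upsilon>) (A v - scale h v - scale (\<epsilon> * \<kappa>) (Y v))" for v
  define Z where "Z v = scale (\<epsilon> / \<kappa>s) (As v - scale hs v)" for v
  define Zinv where "Zinv v = (\<Sum>i\<le>d. scale (m i) (Es i v))" for v
  have X: "Vector_Spaces.linear scale scale X"
    by unfold_locales (simp_all add: X_def D.L.T.add D.L.T.scale Y.add Y.scale algebra_simps)
  have Z: "Vector_Spaces.linear scale scale Z"
    by unfold_locales (simp_all add: Z_def D.R.T.add D.R.T.scale algebra_simps)
  have Zinv: "Vector_Spaces.linear scale scale Zinv"
    by unfold_locales
      (simp_all add: Zinv_def D.R.P_add D.R.P_scale D.scale_right_distrib sum.distrib
        D.scale_sum_right mult.commute)
  have X_u: "X (?u i) = scale (n i) (?u i) + scale (\<epsilon> / \<upsilon>) (?u (Suc i))" if "i \<le> d" for i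
  proof -
    have "A (?u i) - scale h (?u i) - scale (\<epsilon> * \<kappa>) (Y (?u i))
        = scale (\<epsilon> * \<upsilon> * n i) (?u i) + ?u (Suc i)"
      using that by (simp add: A_u Y_u D.scale_left_distrib)
    then show ?thesis
      using nz by (simp add: X_def D.scale_right_distrib \<epsilon>_cancel)
  qed
  have Z_u: "Z (?u i) = scale (n i) (?u i) + scale (\<epsilon> * \<upsilon> * split_coefficient q d i) (?u (i - 1))"
    if "i \<le> d" for i
  proof -
    have "As (?u i) - scale hs (?u i)
        = scale (\<epsilon> * \<kappa>s * n i) (?u i) + scale (\<kappa>s * \<upsilon> * split_coefficient q d i) (?u (i - 1))"
      using that by (simp add: As_u D.scale_left_distrib)
    then show ?thesis
      using nz by (simp add: Z_def D.scale_right_distrib \<epsilon>_cancel)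
  qed
  have Z_Es: "Z (Es i v) = scale (n i) (Es i v)" and Es_Z: "Es i (Z v) = scale (n i) (Es i v)"
    if "i \<le> d" for i v
    using that nz by (simp_all add: Z_def D.R.T_P D.R.P_T D.R.P_scale D.R.P_diff As_eigenvalue
        D.scale_left_distrib \<epsilon>_cancel)
  interpret Z: Vector_Spaces.linear scale scale Z by (rule Z)
  have ZZinv: "Z (Zinv v) = v" for v
    using mn D.R.sum_P[of v] by (simp add: Zinv_def Z.sum Z.scale Z_Es)
  have ZinvZ: "Zinv (Z v) = v" for v
    using mn D.R.sum_P[of v] by (simp add: Zinv_def Es_Z)
  define G where "G = case_uq_gen X Y Z Zinv"
  have lin_G: "Vector_Spaces.linear scale scale (G g)" for g
    using X Y Z Zinv by (cases g) (simp_all add: G_def)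
  have n_sq: "(n i)\<^sup>2 = (q powi (int d - 2 * int i))\<^sup>2" for i
    by (simp add: n_def power_mult_distrib power2_eq_square[of \<epsilon>] \<epsilon>)
  \<comment> \<open>Here \<open>a = \<epsilon> / \<upsilon>\<close> and
    \<open>b = \<epsilon> * \<upsilon>\<close>, with product
    \<open>\<epsilon> * \<epsilon> = 1\<close>. The sign disappears in \<open>(n i)\<^sup>2\<close>,
    so the recurrence applies as stated.\<close>
  have rel_G: "D.uq_relations q G"
    unfolding D.uq_relations_def G_def uq_gen.case
    using D.equitable_relations_on_split_basis[OF q X Y Z D.span_split_vector
        D.split_vector_Suc_d Y_u X_u Z_u _ mn m_Suc split_coefficient_0 split_coefficient_Suc_d]
      split_coefficient_rec[OF q] nz \<epsilon>
    by (simp add: ZZinv ZinvZ n_sq less_Suc_eq_le)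

  have "\<exists>act. uq_module_structure scale q act \<and>
      (\<forall>v. A v = scale h v + scale (\<epsilon> * \<kappa>) (act (uq_y q) v) + scale (\<epsilon> * \<upsilon>) (act (uq_x q) v)) \<and>
      (\<forall>v. As v = scale hs v + scale (\<epsilon> * \<kappa>s) (act (uq_z q) v))"
  proof -
    obtain act where act: "uq_module_structure scale q act" "\<And>g. act (uq_class q (word [g])) = G g"
      using D.uq_module_exists[of G q] lin_G rel_G D.uq_relations_iff[OF assms(1,2)] by metis
    have "A v = scale h v + scale (\<epsilon> * \<kappa>) (Y v) + scale (\<epsilon> * \<upsilon>) (X v)" for v
      using nz by (simp add: X_def \<epsilon>)
    moreover have "As v = scale hs v + scale (\<epsilon> * \<kappa>s) (Z v)" for v
      using nz by (simp add: Z_def \<epsilon>)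
    ultimately show ?thesis
      using act(1) by (intro exI[of _ act]) (simp add: uq_x_def uq_y_def uq_z_def act(2) G_def)
  qed
  moreover have "act = act'"
    if act: "uq_module_structure scale q act"
        "\<forall>v. A v = scale h v + scale (\<epsilon> * \<kappa>) (act (uq_y q) v) + scale (\<epsilon> * \<upsilon>) (act (uq_x q) v)"
        "\<forall>v. As v = scale hs v + scale (\<epsilon> * \<kappa>s) (act (uq_z q) v)"
      and act': "uq_module_structure scale q act'"
        "\<forall>v. A v = scale h v + scale (\<epsilon> * \<kappa>) (act' (uq_y q) v) + scale (\<epsilon> * \<upsilon>) (act' (uq_x q) v)"
        "\<forall>v. As v = scale hs v + scale (\<epsilon> * \<kappa>s) (act' (uq_z q) v)" for act act'
  proof -
    define H where "H g = act (uq_class q (word [g]))" for g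
    define H' where "H' g = act' (uq_class q (word [g]))" for g
    note H = D.uq_module_determined[OF act(1), folded H_def]
    note H' = D.uq_module_determined[OF act'(1), folded H'_def]
    have rel: "D.uq_relations q H" "D.uq_relations q H'"
      using H(3) H'(3) by (auto simp: D.uq_relations_iff[OF assms(1,2)])
    have "H Gen_z v = Z v \<and> H' Gen_z v = Z v" for v
      using act(3)[rule_format, of v] act'(3)[rule_format, of v] nz \<epsilon> \<epsilon>_nz
      by (simp add: Z_def H_def H'_def uq_z_def)
    then have z: "H Gen_z = Z" "H' Gen_z = Z" by auto
    have diff: "scale \<kappa> (H Gen_y v - H' Gen_y v) = - scale \<upsilon> (H Gen_x v - H' Gen_x v)" for v
    proof -
      have "scale (\<epsilon> * \<kappa>) (H Gen_y v) + scale (\<epsilon> * \<upsilon>) (H Gen_x v)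
          = scale (\<epsilon> * \<kappa>) (H' Gen_y v) + scale (\<epsilon> * \<upsilon>) (H' Gen_x v)"
        using act(2)[rule_format, of v] act'(2)[rule_format, of v]
        by (simp add: H_def H'_def uq_x_def uq_y_def)
      then have "scale \<epsilon> (scale \<kappa> (H Gen_y v - H' Gen_y v))
          = scale \<epsilon> (- scale \<upsilon> (H Gen_x v - H' Gen_x v))"
        by (simp add: D.scale_right_diff_distrib algebra_simps)
      then show ?thesis by (rule D.scale_left_imp_eq[OF \<epsilon>_nz])
    qed
    have y_ws: "H Gen_y (ws i) - H' Gen_y (ws i) = 0" if i: "i \<le> d" for i
    proof -
      let ?y = "H Gen_y (ws i) - H' Gen_y (ws i)" and ?x = "H Gen_x (ws i) - H' Gen_x (ws i)"
      have Z_ws: "Z (ws i) = scale (n i) (ws i)"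
        using Z_Es[OF i, of "ws i"] i by (simp add: D.R.P_w)
      have Zy: "Z ?y = scale (q\<^sup>2 * n i) ?y" and Zx: "scale (q\<^sup>2) (Z ?x) = scale (n i) ?x"
        using D.equitable_difference_eigenvector[OF q H(1) rel(1) H'(1) rel(2),
            where v = "ws i" and t = "n i"]
        by (simp_all add: z Z_ws)
      \<comment> \<open>\<open>Z ?y\<close> is computed in two ways, directly and through
        \<open>?x\<close>, which is proportional to \<open>?y\<close>. The eigenvalues
        \<open>q\<^sup>2 * n i\<close> and \<open>n i / q\<^sup>2\<close> must agree unless
        \<open>?y = 0\<close>.\<close>
      have "scale \<kappa> (scale (q\<^sup>2) (Z ?y)) = scale (q\<^sup>2) (Z (scale \<kappa> ?y))"
        by (simp add: Z.scale mult.commute)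
      also have "\<dots> = - scale \<upsilon> (scale (q\<^sup>2) (Z ?x))"
        unfolding diff by (simp add: Z.scale Z.neg mult.commute)
      also have "\<dots> = scale (n i) (scale \<kappa> ?y)"
        unfolding Zx diff by (simp add: mult.commute)
      finally have "scale \<kappa> (scale ((q\<^sup>2 * q\<^sup>2 - 1) * n i) ?y) = 0"
        unfolding Zy by (simp add: D.scale_left_diff_distrib left_diff_distrib mult_ac)
      then have dichotomy: "q\<^sup>2 * q\<^sup>2 = 1 \<or> ?y = 0"
        using nz n_nz[of i] by auto
      show "?y = 0"
      proof (cases "q\<^sup>2 * q\<^sup>2 = 1")
        case False
        then show ?thesis using dichotomy by blast
      next
        case True
        then have "q\<^sup>2 = -1" using assms(2) by (metis square_eq_1_iff)
        have "d < 2"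
        proof (rule ccontr)
          assume "\<not> d < 2"
          \<comment> \<open>Two steps multiply \<open>m\<close> by \<open>q^4 = 1\<close>. For
            \<open>d \<ge> 2\<close> this would make two of the distinct eigenvalues of
            \<open>As\<close> equal.\<close>
          have "m 2 = m 0"
            using m_Suc[of 0] m_Suc[of 1] True by (simp add: numeral_2_eq_2 flip: mult.assoc)
          then have "n 2 = n 0"
            using mn[of 2] mn[of 0] by (metis mult_cancel_left mult_zero_left zero_neq_one)
          then show False
            using inj_onD[OF D.R.inj_t, of 2 0] As_eigenvalue[of 2] As_eigenvalue[of 0] \<open>\<not> d < 2\<close>
            by simp
        qed
        with \<open>q\<^sup>2 = -1\<close> assms(3) have "d = 0" by auto
        \<comment> \<open>For \<open>d = 0\<close> the projection \<open>Es 0\<close> is the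
          identity, so \<open>?y\<close> satisfies the eigenvector equation for \<open>n i\<close>
          as well as for \<open>q\<^sup>2 * n i\<close>, and these differ.\<close>
        then have "?y = Es 0 ?y" using D.R.sum_P[of ?y] by simp
        then have "Z ?y = scale (n i) ?y" using Z_Es[of 0 ?y] i \<open>d = 0\<close> by simp
        with Zy have "scale (n i) ?y = scale (q\<^sup>2 * n i) ?y" by (simp only:)
        then show ?thesis
          unfolding D.scale_cancel_right using n_nz[of i] assms(2) by simp
      qed
    qed
    have Hy: "H Gen_y v = H' Gen_y v" for v
    proof (induction v rule: D.R.w_induct)
      case (w i)
      then show ?case using y_ws[of i] by simp
    qed (use H(1)[of Gen_y] H'(1)[of Gen_y] in
        \<open>simp_all add: linear_iff_module_hom module_hom.add module_hom.scale module_hom.zero\<close>)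
    have Hx: "H Gen_x v = H' Gen_x v" for v
      using diff[of v] nz by (simp add: Hy)
    \<comment> \<open>Both operators are two-sided inverses of the same \<open>Z\<close>.\<close>
    have Hzinv: "H Gen_zinv v = H' Gen_zinv v" for v
      using rel z by (metis D.uq_relations_def)
    have "H g = H' g" for g
      using Hx Hy Hzinv z by (cases g) auto
    then have "H = H'" by auto
    show "act = act'"
    proof (rule extensionalityI[where A = "carrier (Uq q)"])
      show "act \<in> extensional (carrier (Uq q))" "act' \<in> extensional (carrier (Uq q))"
        using act(1) act'(1) by (auto simp: uq_module_structure_def)
      fix a assume "a \<in> carrier (Uq q)"
      then obtain f where "f \<in> carrier free_algebra" "a = uq_class q f"
        by (rule uq_class_surj)
      then show "act a = act' a"
        using H(2) H'(2) \<open>H = H'\<close> by auto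
    qed
  qed
  ultimately show ?thesis by blast
qed

end
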